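(* Consider the partially ordered set of $\operatorname{GL}(\mathbb{R}^4,J_{\mathrm{cn}})$-orbits in $\mathcal{L}_{J_{\mathrm{cn}}}(\mathbb{R}^4)$, ordered by degeneration ($\operatorname{GL}(\mathbb{R}^4,J_{\mathrm{cn}})\cdot\mu \ge \operatorname{GL}(\mathbb{R}^4,J_{\mathrm{cn}})\cdot\lambda$ iff $\lambda\in\overline{\operatorname{GL}(\mathbb{R}^4,J_{\mathrm{cn}})\cdot\mu}$), whose elements are represented by the brackets in the list given in the context. The Hasse diagram of this poset consists exactly of the following arrows. That is, these are the covering relations, and for two brackets $\mu,\lambda$ of the list, $(\mathbb{R}^4,\mu,J_{\mathrm{cn}})$ properly degenerates to $(\mathbb{R}^4,\lambda,J_{\mathrm{cn}})$ with respect to $\operatorname{GL}(\mathbb{R}^4,J_{\mathrm{cn}})$ if and only if there is a directed path of length at least one from $\mu$ to $\lambda$ formed by these arrows. (1) $\mu_{13,+}(0)\to\mu_7(0)$; $\mu_{13,-}(0)\to\mu_7(0)$; $\mu_{8,+}(t)\to\mu_7(0)$ and $\mu_{8,-}(t)\to\mu_7(0)$ for every $t\in\mathbb{R}$; $\mu_{8,-}(0)\to\mu_{10}(0)$; $\mu_{12}\to\mu_{10}(0)$. (2) $\mu_2\to\mu_{10}(1)$; $\mu_2\to\mu_6(0,0)$; $\mu_4\to\mu_{10}(1)$; $\mu_4\to\mu_3(0,1)$. (3) $\mu_5\to\mu_3(0,-1)$; $\mu_5\to\mu_1$. (4) For every $\delta>0$: $\mu_{13,-}(-\tfrac{1}{2\delta})\to\mu_6(\tfrac12,\delta)$;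 $\mu_{13,+}(\tfrac{1}{2\delta})\to\mu_6(\tfrac12,\delta)$; $\mu_{13,+}(-\tfrac{1}{2\delta})\to\mu_6(\tfrac12,-\delta)$; $\mu_{13,-}(\tfrac{1}{2\delta})\to\mu_6(\tfrac12,-\delta)$. (5) $\mu_{11}(+)\to\mu_6(\tfrac12,0)$; $\mu_{11}(-)\to\mu_6(\tfrac12,0)$; $\mu_{11}(-)\to\mu_{10}(2)$; $\mu_{14}\to\mu_{10}(2)$; $\mu_9\to\mu_6(1,0)$; $\mu_9\to\mu_1$. (6) $\mu_3(a,b)\to\mu_1$ for all $a\in\mathbb{R}$, $b\neq0$ with $(a,b)\ne(0,-1)$; $\mu_3(0,0)\to\mu_1$; $\mu_6(a,b)\to\mu_1$ for all $(a,b)\in\mathbb{R}^2$ with $(a,b)\neq(1,0)$; $\mu_7(a)\to\mu_1$ for all $a\in\mathbb{R}$; $\mu_{10}(a)\to\mu_1$ for all $a\in\mathbb{R}$. (7) $\mu_1\to\mu_0$; $\mu_3(0,-1)\to\mu_0$; $\mu_6(1,0)\to\mu_0$.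
   Context: Let $e_1,\dots,e_4$ be the canonical basis of $\mathbb{R}^4$ and let $J_{\mathrm{cn}}$ be the linear map with $J_{\mathrm{cn}}e_1=e_3$, $J_{\mathrm{cn}}e_2=e_4$, $J_{\mathrm{cn}}e_3=-e_1$, $J_{\mathrm{cn}}e_4=-e_2$. Let $\operatorname{GL}(\mathbb{R}^{4},J_{\mathrm{cn}})=\{g\in\operatorname{GL}(\mathbb{R}^4): gJ_{\mathrm{cn}}=J_{\mathrm{cn}}g\}$, acting on alternating bilinear maps $\mu:\mathbb{R}^4\times\mathbb{R}^4\to\mathbb{R}^4$ by $(g\cdot\mu)(X,Y)=g\mu(g^{-1}X,g^{-1}Y)$. $\mathcal{L}_{J_{\mathrm{cn}}}(\mathbb{R}^4)$ is the set of alternating bilinear maps $\mu$ that satisfy the Jacobi identity and $\mu(X,Y)-\mu(J_{\mathrm{cn}}X,J_{\mathrm{cn}}Y)+J_{\mathrm{cn}}\mu(J_{\mathrm{cn}}X,Y)+J_{\mathrm{cn}}\mu(X,J_{\mathrm{cn}}Y)=0$ for all $X,Y$. Closures are taken in the usual (Hausdorff) topology of the finite-dimensional real vector space of alternating bilinear maps. For $\mu,\lambda\in\mathcal{L}_{J_{\mathrm{cn}}}(\mathbb{R}^4)$, $(\mathbb{R}^4,\mu,J_{\mathrm{cn}})$ degenerates to $(\mathbb{R}^4,\lambda,J_{\mathrm{cn}})$ with respect to $\operatorname{GL}(\mathbb{R}^4,J_{\mathrm{cn}})$ if $\lambda\in\overline{\operatorname{GL}(\mathbb{R}^4,J_{\mathrm{cn}})\cdot\mu}$;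 the degeneration is proper if moreover $\lambda\notin\operatorname{GL}(\mathbb{R}^4,J_{\mathrm{cn}})\cdot\mu$. This relation induces a partial order on the set of orbits. List of brackets (brackets of basis vectors that are not listed and not determined by antisymmetry are zero). By the classification of complex structures on four-dimensional real Lie algebras, every $\operatorname{GL}(\mathbb{R}^4,J_{\mathrm{cn}})$-orbit in $\mathcal{L}_{J_{\mathrm{cn}}}(\mathbb{R}^4)$ contains exactly one of them: - $\mu_0=0$. - $\mu_1$: $[e_1,e_3]=e_2$. - $\mu_2$: $[e_1,e_3]=e_3$, $[e_2,e_4]=e_4$. - $\mu_3(a,b)$, with either $a\in\mathbb{R}$, $b\neq 0$, or $(a,b)=(0,0)$: $[e_1,e_2]=e_2$, $[e_1,e_4]=e_4$, $[e_2,e_3]=ae_2+be_4$, $[e_3,e_4]=be_2-ae_4$. - $\mu_4$: $[e_1,e_3]=e_3$, $[e_1,e_4]=e_4$, $[e_2,e_3]=e_4$, $[e_2,e_4]=-e_3$. - $\mu_5$: $[e_1,e_2]=e_2$, $[e_1,e_3]=e_4$, $[e_1,e_4]=e_4$, $[e_2,e_3]=-e_4$, $[e_3,e_4]=-e_2$. - $\mu_6(a,b)$, $(a,b)\in\mathbb{R}^2$: $[e_1,e_2]=ae_2+be_4$, $[e_1,e_3]=e_3$, $[e_1,e_4]=-be_2+ae_4$. - $\mu_7(a)$, $a\in\mathbb{R}$: $[e_1,e_2]=ae_2+e_4$, $[e_1,e_4]=-e_2+ae_4$. - $\mu_{8,+}(a)$, $a\in\mathbb{R}$: $[e_1,e_2]=e_3$,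 $[e_1,e_3]=-e_2+ae_4$, $[e_2,e_3]=e_1$. - $\mu_{8,-}(a)$, $a\in\mathbb{R}$: $[e_1,e_2]=e_3$, $[e_1,e_3]=e_2+ae_4$, $[e_2,e_3]=e_1$. - $\mu_9$: $[e_1,e_2]=e_2$, $[e_1,e_3]=e_3+e_4$, $[e_1,e_4]=e_4$. - $\mu_{10}(a)$, $a\in\mathbb{R}$: $[e_1,e_2]=(a-1)e_2$, $[e_1,e_3]=e_3$, $[e_1,e_4]=ae_4$, $[e_2,e_3]=e_4$. - $\mu_{11}(+)$: $[e_1,e_2]=\tfrac12e_2$, $[e_1,e_3]=e_3$, $[e_1,e_4]=\tfrac12e_4$, $[e_2,e_4]=e_3$. - $\mu_{11}(-)$: $[e_1,e_2]=-\tfrac12e_2$, $[e_1,e_3]=-e_3$, $[e_1,e_4]=-\tfrac12e_4$, $[e_2,e_4]=e_3$. - $\mu_{12}$: $[e_1,e_2]=-e_2$, $[e_1,e_3]=e_3+e_4$, $[e_2,e_3]=e_4$. - $\mu_{13,+}(a)$, $a\in\mathbb{R}$: $[e_1,e_2]=ae_2+e_4$, $[e_1,e_3]=2ae_3$, $[e_1,e_4]=-e_2+ae_4$, $[e_2,e_4]=e_3$. - $\mu_{13,-}(a)$, $a\in\mathbb{R}$: $[e_1,e_2]=ae_2-e_4$, $[e_1,e_3]=2ae_3$, $[e_1,e_4]=e_2+ae_4$, $[e_2,e_4]=e_3$. - $\mu_{14}$: $[e_1,e_2]=e_2$, $[e_1,e_3]=e_2+e_3$, $[e_1,e_4]=2e_4$,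 $[e_2,e_3]=e_4$. *)

theory Defs
  imports "HOL-Analysis.Analysis"
begin

section \<open>Brackets on \<open>\<real>\<^sup>4\<close> compatible with the standard complex structure\<close>

text \<open>
  A bilinear map on \<open>\<real>\<^sup>4\<close> is an element of the normed space below (in finite dimension every
  bilinear map is bounded).  The alternating maps form a closed linear subspace, so closures
  formed in this type are closures in the usual topology of the space of alternating maps.
  In the index type \<open>4\<close> the numeral \<open>4\<close> equals \<open>0\<close>; the indices \<open>1, 2, 3, 4\<close> are distinct.
\<close>

type_synonym bilin = "(real^4) \<Rightarrow>\<^sub>L (real^4) \<Rightarrow>\<^sub>L (real^4)"

abbreviation e :: "4 \<Rightarrow> real^4" where
  "e i \<equiv> axis i 1"

definition Jcn :: "real^4 \<Rightarrow> real^4" where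
  "Jcn X = (X $ 1) *\<^sub>R e 3 + (X $ 2) *\<^sub>R e 4 - (X $ 3) *\<^sub>R e 1 - (X $ 4) *\<^sub>R e 2"

lemma Jcn_basis: "Jcn (e 1) = e 3" "Jcn (e 2) = e 4" "Jcn (e 3) = - e 1" "Jcn (e 4) = - e 2"
  by (auto simp: Jcn_def axis_def vec_eq_iff)

definition GLJ :: "(real^4 \<Rightarrow> real^4) set" where
  "GLJ = {g. linear g \<and> bij g \<and> g \<circ> Jcn = Jcn \<circ> g}"

text \<open>\<open>Blinfun\<close> is meaningful only on bounded linear maps; see \<open>mk_bilin_apply\<close>.\<close>

definition mk_bilin :: "(real^4 \<Rightarrow> real^4 \<Rightarrow> real^4) \<Rightarrow> bilin" where
  "mk_bilin f = Blinfun (\<lambda>X. Blinfun (f X))"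

definition act :: "(real^4 \<Rightarrow> real^4) \<Rightarrow> bilin \<Rightarrow> bilin" where
  "act g \<mu> = mk_bilin (\<lambda>X Y. g (\<mu> (inv g X) (inv g Y)))"

definition LJ :: "bilin set" where
  "LJ = {\<mu> :: bilin. (\<forall>X. \<mu> X X = 0)
          \<and> (\<forall>X Y Z. \<mu> (\<mu> X Y) Z + \<mu> (\<mu> Y Z) X + \<mu> (\<mu> Z X) Y = 0)
          \<and> (\<forall>X Y. \<mu> X Y - \<mu> (Jcn X) (Jcn Y) + Jcn (\<mu> (Jcn X) Y) + Jcn (\<mu> X (Jcn Y)) = 0)}"

lemma mk_bilin_apply:
  assumes "bilinear f"
  shows "mk_bilin f X Y = f X Y"
proof -
  have bb: "bounded_bilinear f"
    using assms by (simp add: bilinear_conv_bounded_bilinear)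
  have 1: "blinfun_apply (Blinfun (f X)) = f X" for X
    using bounded_bilinear.bounded_linear_right[OF bb] by (rule bounded_linear_Blinfun_apply)
  obtain K where K: "\<And>a b. norm (f a b) \<le> norm a * norm b * K" and "K \<ge> 0"
    using bounded_bilinear.nonneg_bounded[OF bb] by blast
  have "bounded_linear (\<lambda>X. Blinfun (f X))"
  proof (rule bounded_linear_intro)
    show "norm (Blinfun (f a)) \<le> norm a * K" for a
    proof (rule norm_blinfun_bound)
      show "norm (Blinfun (f a) b) \<le> norm a * K * norm b" for b
        using K[of a b] by (simp add: 1 mult.assoc mult.commute[of K])
    qed (use \<open>K \<ge> 0\<close> in simp)
  qed (auto intro!: blinfun_eqI simp: 1 blinfun.add_left blinfun.scaleR_left
        bounded_bilinear.add_left[OF bb] bounded_bilinear.scaleR_left[OF bb])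
  then show ?thesis
    by (simp add: mk_bilin_def bounded_linear_Blinfun_apply 1)
qed

lemma act_apply:
  assumes "linear g" "bij g"
  shows "act g \<mu> X Y = g (\<mu> (inv g X) (inv g Y))"
proof -
  have li: "linear (inv g)"
    using assms by (simp add: bij_def inj_linear_imp_inv_linear)
  have "bilinear (\<lambda>X Y. g (\<mu> (inv g X) (inv g Y)))"
    unfolding bilinear_def
    by (auto intro!: linearI simp: linear_add[OF assms(1)] linear_add[OF li]
          linear_scale[OF assms(1)] linear_scale[OF li] blinfun.bilinear_simps)
  then show ?thesis
    unfolding act_def by (rule mk_bilin_apply)
qed

section \<open>Orbits and degeneration\<close>

definition orb :: "bilin \<Rightarrow> bilin set" where
  "orb \<mu> = (\<lambda>g. act g \<mu>) ` GLJ"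

definition degenerates :: "bilin \<Rightarrow> bilin \<Rightarrow> bool" where
  "degenerates \<mu> \<nu> \<longleftrightarrow> \<mu> \<in> LJ \<and> \<nu> \<in> LJ \<and> \<nu> \<in> closure (orb \<mu>)"

definition properly_degenerates :: "bilin \<Rightarrow> bilin \<Rightarrow> bool" where
  "properly_degenerates \<mu> \<nu> \<longleftrightarrow> degenerates \<mu> \<nu> \<and> \<nu> \<notin> orb \<mu>"

definition orbits :: "bilin set set" where
  "orbits = orb ` LJ"

definition orbit_ge :: "bilin set \<Rightarrow> bilin set \<Rightarrow> bool" where
  "orbit_ge A B \<longleftrightarrow> (\<exists>\<mu> \<nu>. A = orb \<mu> \<and> B = orb \<nu> \<and> degenerates \<mu> \<nu>)"

definition orbit_gt :: "bilin set \<Rightarrow> bilin set \<Rightarrow> bool" where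
  "orbit_gt A B \<longleftrightarrow> orbit_ge A B \<and> A \<noteq> B"

text \<open>The intermediate orbit ranges over all orbits in \<open>LJ\<close>, not only over those of the
  representatives listed below.\<close>

definition covers :: "bilin set \<Rightarrow> bilin set \<Rightarrow> bool" where
  "covers A B \<longleftrightarrow> A \<in> orbits \<and> B \<in> orbits \<and> orbit_gt A B
     \<and> \<not> (\<exists>C \<in> orbits. orbit_gt A C \<and> orbit_gt C B)"

section \<open>The list of representatives\<close>

text \<open>An entry \<open>(i, j, v)\<close> stands for \<open>[e\<^sub>i, e\<^sub>j] = v\<close> and hence \<open>[e\<^sub>j, e\<^sub>i] = -v\<close>.\<close>

definition table :: "(4 \<times> 4 \<times> (real^4)) list \<Rightarrow> bilin" where
  "table T = mk_bilin (\<lambda>X Y. \<Sum>(i, j, v)\<leftarrow>T. (X $ i * Y $ j - X $ j * Y $ i) *\<^sub>R v)"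

lemma table_apply:
  "table T X Y = (\<Sum>(i, j, v)\<leftarrow>T. (X $ i * Y $ j - X $ j * Y $ i) *\<^sub>R v)"
proof -
  have "bilinear (\<lambda>X Y. \<Sum>(i, j, v)\<leftarrow>T. (X $ i * Y $ j - X $ j * Y $ i) *\<^sub>R (v :: real^4))"
    unfolding bilinear_def
    by (induction T) (auto intro!: linearI simp: linear_iff algebra_simps)
  then show ?thesis
    unfolding table_def by (rule mk_bilin_apply)
qed

datatype mu_name =
    Mu0 | Mu1 | Mu2 | Mu3 real real | Mu4 | Mu5 | Mu6 real real | Mu7 real
  | Mu8p real | Mu8m real | Mu9 | Mu10 real | Mu11p | Mu11m | Mu12
  | Mu13p real | Mu13m real | Mu14

fun listed :: "mu_name \<Rightarrow> bool" where
  "listed (Mu3 a b) \<longleftrightarrow> b \<noteq> 0 \<or> (a = 0 \<and> b = 0)"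
| "listed _ \<longleftrightarrow> True"

fun bracket :: "mu_name \<Rightarrow> bilin" where
  "bracket Mu0 = 0"
| "bracket Mu1 = table [(1, 3, e 2)]"
| "bracket Mu2 = table [(1, 3, e 3), (2, 4, e 4)]"
| "bracket (Mu3 a b) = table [(1, 2, e 2), (1, 4, e 4),
     (2, 3, a *\<^sub>R e 2 + b *\<^sub>R e 4), (3, 4, b *\<^sub>R e 2 - a *\<^sub>R e 4)]"
| "bracket Mu4 = table [(1, 3, e 3), (1, 4, e 4), (2, 3, e 4), (2, 4, - e 3)]"
| "bracket Mu5 = table [(1, 2, e 2), (1, 3, e 4), (1, 4, e 4), (2, 3, - e 4), (3, 4, - e 2)]"
| "bracket (Mu6 a b) = table [(1, 2, a *\<^sub>R e 2 + b *\<^sub>R e 4), (1, 3, e 3),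
     (1, 4, - b *\<^sub>R e 2 + a *\<^sub>R e 4)]"
| "bracket (Mu7 a) = table [(1, 2, a *\<^sub>R e 2 + e 4), (1, 4, - e 2 + a *\<^sub>R e 4)]"
| "bracket (Mu8p a) = table [(1, 2, e 3), (1, 3, - e 2 + a *\<^sub>R e 4), (2, 3, e 1)]"
| "bracket (Mu8m a) = table [(1, 2, e 3), (1, 3, e 2 + a *\<^sub>R e 4), (2, 3, e 1)]"
| "bracket Mu9 = table [(1, 2, e 2), (1, 3, e 3 + e 4), (1, 4, e 4)]"
| "bracket (Mu10 a) = table [(1, 2, (a - 1) *\<^sub>R e 2), (1, 3, e 3), (1, 4, a *\<^sub>R e 4), (2, 3, e 4)]"
| "bracket Mu11p = table [(1, 2, (1/2) *\<^sub>R e 2), (1, 3, e 3), (1, 4, (1/2) *\<^sub>R e 4), (2, 4, e 3)]"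
| "bracket Mu11m = table [(1, 2, (-1/2) *\<^sub>R e 2), (1, 3, - e 3), (1, 4, (-1/2) *\<^sub>R e 4), (2, 4, e 3)]"
| "bracket Mu12 = table [(1, 2, - e 2), (1, 3, e 3 + e 4), (2, 3, e 4)]"
| "bracket (Mu13p a) = table [(1, 2, a *\<^sub>R e 2 + e 4), (1, 3, (2 * a) *\<^sub>R e 3),
     (1, 4, - e 2 + a *\<^sub>R e 4), (2, 4, e 3)]"
| "bracket (Mu13m a) = table [(1, 2, a *\<^sub>R e 2 - e 4), (1, 3, (2 * a) *\<^sub>R e 3),
     (1, 4, e 2 + a *\<^sub>R e 4), (2, 4, e 3)]"
| "bracket Mu14 = table [(1, 2, e 2), (1, 3, e 2 + e 3), (1, 4, 2 *\<^sub>R e 4), (2, 3, e 4)]"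

section \<open>The arrows of the diagram\<close>

inductive arrow :: "mu_name \<Rightarrow> mu_name \<Rightarrow> bool" where
  "arrow (Mu13p 0) (Mu7 0)"
| "arrow (Mu13m 0) (Mu7 0)"
| "arrow (Mu8p t) (Mu7 0)"
| "arrow (Mu8m t) (Mu7 0)"
| "arrow (Mu8m 0) (Mu10 0)"
| "arrow Mu12 (Mu10 0)"

| "arrow Mu2 (Mu10 1)"
| "arrow Mu2 (Mu6 0 0)"
| "arrow Mu4 (Mu10 1)"
| "arrow Mu4 (Mu3 0 1)"

| "arrow Mu5 (Mu3 0 (-1))"
| "arrow Mu5 Mu1"

| "\<delta> > 0 \<Longrightarrow> arrow (Mu13m (- 1 / (2 * \<delta>))) (Mu6 (1/2) \<delta>)"
| "\<delta> > 0 \<Longrightarrow> arrow (Mu13p (1 / (2 * \<delta>))) (Mu6 (1/2) \<delta>)"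
| "\<delta> > 0 \<Longrightarrow> arrow (Mu13p (- 1 / (2 * \<delta>))) (Mu6 (1/2) (- \<delta>))"
| "\<delta> > 0 \<Longrightarrow> arrow (Mu13m (1 / (2 * \<delta>))) (Mu6 (1/2) (- \<delta>))"

| "arrow Mu11p (Mu6 (1/2) 0)"
| "arrow Mu11m (Mu6 (1/2) 0)"
| "arrow Mu11m (Mu10 2)"
| "arrow Mu14 (Mu10 2)"
| "arrow Mu9 (Mu6 1 0)"
| "arrow Mu9 Mu1"

| "b \<noteq> 0 \<Longrightarrow> (a, b) \<noteq> (0, -1) \<Longrightarrow> arrow (Mu3 a b) Mu1"
| "arrow (Mu3 0 0) Mu1"
| "(a, b) \<noteq> (1, 0) \<Longrightarrow> arrow (Mu6 a b) Mu1"
| "arrow (Mu7 a) Mu1"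
| "arrow (Mu10 a) Mu1"

| "arrow Mu1 Mu0"
| "arrow (Mu3 0 (-1)) Mu0"
| "arrow (Mu6 1 0) Mu0"

end

theory Submission
  imports Defs
begin

text \<open>
  Identify \<open>\<real>\<^sup>4\<close> with \<open>\<complex>\<^sup>2\<close> via \<open>J\<^sub>c\<^sub>n = \<i>\<close>, so that \<open>GLJ\<close> becomes \<open>GL\<^sub>2(\<complex>)\<close> and every bracket of the list
  is given by ten complex structure constants.  Since \<open>GL\<^sub>2(\<complex>)\<close> is the product of the compact
  unitary group and of the lower triangular matrices with positive diagonal, every point in the
  closure of an orbit is equivalent to a limit of brackets obtained by triangular changes of basis
  only.  For a suitable representative of each orbit these form an explicit family, whose closure
  is cut out by a few equations and inequalities, and every point of which is brought to a bracket
  of the list.  Hence the closure of each orbit is a union of listed orbits, without any appeal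
  to the classification.  If a listed bracket lies in the orbit of an arrow target, comparing the
  structure constants forces the change of basis to be triangular, and the two coincide.
  The arrows lower a rank function by exactly one, hence they are covering relations.
\<close>

section \<open>Complex coordinates\<close>

text \<open>The obstacle is that a limit of triangular changes of basis need not be one: a diagonal
  entry tending to 0 in a denominator leaves a structure constant undetermined. The representatives
  are chosen so that all constants but one are real-linear in the diagonal entries and the shear
  \<open>\<beta>\<close>; only \<open>p2\<close>, the component of \<open>[e 1, e 3]\<close> along
  the complex line of \<open>e 2\<close>, carries the denominator \<open>\<gamma>\<close>. It
  becomes a free coordinate \<open>\<pi>\<close>, tied to the rest by an equation cleared of
  denominators, which turns the family into an injective linear image of a closed set. The strata
  where a diagonal entry vanishes give the lower orbits.

  For brackets with an abelian ideal through \<open>e 2\<close>, a shear moves \<open>p\<close> by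
  the real-linear map \<open>\<beta> * (B - P) + cnj \<beta> * R\<close>, and its rank decides what
  happens. In rank 2 every \<open>p\<close> is equivalent; rank 1 explains the special role of
  \<open>Mu10 0\<close> and \<open>Mu10 2\<close>, with \<open>Mu12\<close> and \<open>Mu14\<close>
  above them; in rank 0 and for \<open>p = 0\<close> nothing produces \<mu>_1, which is why
  \<open>Mu3 0 (-1)\<close> and \<open>Mu6 1 0\<close> drop directly to 0.\<close>

definition c1 :: "real^4 \<Rightarrow> complex" where "c1 X = Complex (X $ 1) (X $ 3)"
definition c2 :: "real^4 \<Rightarrow> complex" where "c2 X = Complex (X $ 2) (X $ 4)"
definition cvec :: "complex \<Rightarrow> complex \<Rightarrow> real^4" where
  "cvec z w = Re z *\<^sub>R e 1 + Re w *\<^sub>R e 2 + Im z *\<^sub>R e 3 + Im w *\<^sub>R e 4"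

lemma cvec_nth [simp]:
  "cvec z w $ 1 = Re z" "cvec z w $ 2 = Re w" "cvec z w $ 3 = Im z" "cvec z w $ 4 = Im w"
  by (auto simp: cvec_def axis_def)

lemma c_cvec [simp]: "c1 (cvec z w) = z" "c2 (cvec z w) = w"
  by (auto simp: c1_def c2_def)

lemma cvec_eqI: "c1 X = c1 Y \<Longrightarrow> c2 X = c2 Y \<Longrightarrow> X = Y"
  by (auto simp: c1_def c2_def vec_eq_iff forall_4)

lemma cvec_c [simp]: "cvec (c1 X) (c2 X) = X"
  by (rule cvec_eqI) auto

lemma cvec_eq_iff [simp]: "cvec z w = cvec z' w' \<longleftrightarrow> z = z' \<and> w = w'"
  by (metis c_cvec)

lemma c_linear [simp]:
  "c1 (X + Y) = c1 X + c1 Y" "c2 (X + Y) = c2 X + c2 Y"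
  "c1 (X - Y) = c1 X - c1 Y" "c2 (X - Y) = c2 X - c2 Y"
  "c1 (- X) = - c1 X" "c2 (- X) = - c2 X"
  "c1 (t *\<^sub>R X) = of_real t * c1 X" "c2 (t *\<^sub>R X) = of_real t * c2 X" "c1 0 = 0" "c2 0 = 0"
  by (auto simp: c1_def c2_def complex_eq_iff)

lemma cvec_eq_0_iff [simp]: "cvec z w = 0 \<longleftrightarrow> z = 0 \<and> w = 0"
  by (metis c_cvec c_linear(9,10) cvec_c)

lemma cvec_00 [simp]: "cvec 0 0 = 0"
  by simp

lemma c_Jcn [simp]: "c1 (Jcn X) = \<i> * c1 X" "c2 (Jcn X) = \<i> * c2 X"
  by (auto simp: c1_def c2_def Jcn_def axis_def complex_eq_iff)

lemma e_cvec: "e 1 = cvec 1 0" "e 2 = cvec 0 1" "e 3 = cvec \<i> 0" "e 4 = cvec 0 \<i>"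
  by (auto simp: cvec_def)

lemma continuous_on_c [continuous_intros]:
  assumes "continuous_on S f"
  shows "continuous_on S (\<lambda>x. c1 (f x))" "continuous_on S (\<lambda>x. c2 (f x))"
  using assms unfolding c1_def c2_def Complex_eq by (auto intro!: continuous_intros)

lemma continuous_on_cvec [continuous_intros]:
  assumes "continuous_on S f" "continuous_on S g"
  shows "continuous_on S (\<lambda>x. cvec (f x) (g x))"
  using assms unfolding cvec_def by (auto intro!: continuous_intros)

type_synonym par = "complex \<times> complex \<times> complex \<times> complex \<times> complex \<times> complex \<times> complex
  \<times> complex \<times> complex \<times> complex"

lemma par_cases:
  fixes x :: par
  obtains a1 a2 p1 p2 q1 q2 r1 r2 s1 s2 where "x = (a1, a2, p1, p2, q1, q2, r1, r2, s1, s2)"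
  by (metis surj_pair)

text \<open>
  The structure constants \<open>a\<close>, \<open>p\<close>, \<open>q\<close>, \<open>r\<close>, \<open>s\<close> are vectors in \<open>\<complex>\<^sup>2\<close>: \<open>a\<close> is the \<open>(2,0)\<close> part of the
  bracket and the others make up its \<open>(1,1)\<close> part; integrability kills the \<open>(0,2)\<close> part.
\<close>

fun brf :: "par \<Rightarrow> real^4 \<Rightarrow> real^4 \<Rightarrow> real^4" where
  "brf (a1, a2, p1, p2, q1, q2, r1, r2, s1, s2) X Y =
     (let z = c1 X; w = c2 X; z' = c1 Y; w' = c2 Y;
          a = z * w' - w * z'; p = cnj z * z' - cnj z' * z; q = cnj z * w' - cnj z' * w;
          r = cnj w * z' - cnj w' * z; s = cnj w * w' - cnj w' * w
      in cvec (a1 * a + p1 * p + q1 * q + r1 * r + s1 * s)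
              (a2 * a + p2 * p + q2 * q + r2 * r + s2 * s))"

definition br :: "par \<Rightarrow> bilin" where "br x = mk_bilin (brf x)"

lemma bilinear_brf: "bilinear (brf x)"
  unfolding bilinear_def
  by (cases x rule: par_cases) (auto intro!: linearI cvec_eqI simp: Let_def algebra_simps)

lemma br_apply [simp]: "br x X Y = brf x X Y"
  unfolding br_def by (rule mk_bilin_apply[OF bilinear_brf])

text \<open>Five values suffice: the remaining one, on \<open>e 3\<close> and \<open>e 4\<close>, is
  determined by integrability. The combinations with \<open>\<i>\<close> separate the parts that are
  linear or conjugate-linear in each argument.\<close>

fun bcoef :: "(real^4 \<Rightarrow> real^4 \<Rightarrow> real^4) \<Rightarrow> par" where
  "bcoef f = 
    (let uv = f (e 1) (e 2); uiv = f (e 1) (e 4); iuv = f (e 3) (e 2); uu = f (e 1) (e 3); vv = f (e 2) (e 4)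
     in (- \<i> * (c1 uiv + c1 iuv) / 2, - \<i> * (c2 uiv + c2 iuv) / 2,
         - \<i> / 2 * c1 uu, - \<i> / 2 * c2 uu,
         (c1 uv + \<i> * c1 iuv) / 2, (c2 uv + \<i> * c2 iuv) / 2,
         - (c1 uv + \<i> * c1 uiv) / 2, - (c2 uv + \<i> * c2 uiv) / 2,
         - \<i> / 2 * c1 vv, - \<i> / 2 * c2 vv))"

definition coef :: "bilin \<Rightarrow> par" where "coef \<mu> = bcoef (\<lambda>X. blinfun_apply (blinfun_apply \<mu> X))"

lemma coef_br [simp]: "coef (br x) = x"
  by (cases x rule: par_cases)
    (simp only: coef_def bcoef.simps e_cvec br_apply brf.simps Let_def c_cvec prod.inject,
     simp add: algebra_simps)

lemma br_inject: "br x = br y \<longleftrightarrow> x = y"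
  by (metis coef_br)

lemma continuous_on_coef: "continuous_on S coef"
  unfolding coef_def bcoef.simps Let_def by (intro continuous_intros) auto

lemma continuous_on_bilin:
  fixes f :: "'a::t2_space \<Rightarrow> bilin"
  assumes "\<And>X Y. continuous_on S (\<lambda>x. f x X Y)"
  shows "continuous_on S f"
  by (intro continuous_on_blinfun_componentwise assms)

lemma linear_br: "linear br"
proof (rule linearI)
  show "br (x + y) = br x + br y" for x y
    by (cases x rule: par_cases; cases y rule: par_cases)
      (simp, intro blinfun_eqI cvec_eqI; simp add: Let_def algebra_simps plus_blinfun.rep_eq)
  show "br (t *\<^sub>R x) = t *\<^sub>R br x" for t x
    by (cases x rule: par_cases)
      (simp, intro blinfun_eqI cvec_eqI; simp add: Let_def algebra_simps scaleR_blinfun.rep_eq scaleR_conv_of_real[where 'a = complex])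
qed

lemma continuous_on_br: "continuous_on S br"
  using linear_br by (simp add: linear_continuous_on linear_conv_bounded_linear)

text \<open>\<open>coef\<close> is a continuous left inverse of \<open>br\<close>, so membership in
  the image splits into two closed conditions.\<close>

lemma closed_br_image:
  assumes Q: "closed Q"
  shows "closed (br ` Q)"
proof -
  have "\<mu> \<in> br ` Q \<longleftrightarrow> coef \<mu> \<in> Q \<and> br (coef \<mu>) = \<mu>" for \<mu>
  proof
    assume "\<mu> \<in> br ` Q"
    then obtain x where "\<mu> = br x" "x \<in> Q" by blast
    then show "coef \<mu> \<in> Q \<and> br (coef \<mu>) = \<mu>" by simp
  next
    assume "coef \<mu> \<in> Q \<and> br (coef \<mu>) = \<mu>"
    then show "\<mu> \<in> br ` Q" by (intro image_eqI[of _ _ "coef \<mu>"]) simp_all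
  qed
  then have "br ` Q = coef -` Q \<inter> {\<mu>. br (coef \<mu>) = \<mu>}"
    by blast
  moreover have "closed (coef -` Q)"
    using Q continuous_on_coef by (rule closed_vimage)
  moreover have "closed {\<mu>. br (coef \<mu>) = \<mu>}"
    by (intro closed_Collect_eq continuous_on_id
       continuous_on_compose2[OF continuous_on_br[of UNIV] continuous_on_coef] subset_UNIV)
  ultimately show ?thesis by (simp add: closed_Int)
qed

section \<open>Orbits\<close>

definition gm :: "complex \<Rightarrow> complex \<Rightarrow> complex \<Rightarrow> complex \<Rightarrow> real^4 \<Rightarrow> real^4" where
  "gm \<alpha> \<beta> \<delta> \<gamma> X = cvec (\<alpha> * c1 X + \<delta> * c2 X) (\<beta> * c1 X + \<gamma> * c2 X)"

lemma c_gm [simp]: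
  "c1 (gm \<alpha> \<beta> \<delta> \<gamma> X) = \<alpha> * c1 X + \<delta> * c2 X" "c2 (gm \<alpha> \<beta> \<delta> \<gamma> X) = \<beta> * c1 X + \<gamma> * c2 X"
  by (auto simp: gm_def)

lemma linear_gm: "linear (gm \<alpha> \<beta> \<delta> \<gamma>)"
  by (auto intro!: linearI cvec_eqI simp: algebra_simps)

lemma gm_inverse:
  assumes "\<alpha> * \<gamma> - \<delta> * \<beta> = D" "D \<noteq> 0"
  shows "gm \<alpha> \<beta> \<delta> \<gamma> (gm (\<gamma> / D) (- \<beta> / D) (- \<delta> / D) (\<alpha> / D) X) = X"
    "gm (\<gamma> / D) (- \<beta> / D) (- \<delta> / D) (\<alpha> / D) (gm \<alpha> \<beta> \<delta> \<gamma> X) = X"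
  using assms(2) unfolding assms(1)[symmetric]
  by (auto intro!: cvec_eqI simp: divide_simps) (simp_all add: algebra_simps)

lemma gm_GLJ:
  assumes "\<alpha> * \<gamma> - \<delta> * \<beta> \<noteq> 0"
  shows "gm \<alpha> \<beta> \<delta> \<gamma> \<in> GLJ"
proof -
  have "bij (gm \<alpha> \<beta> \<delta> \<gamma>)"
    using gm_inverse[OF refl assms] by (metis bijI')
  moreover have "gm \<alpha> \<beta> \<delta> \<gamma> \<circ> Jcn = Jcn \<circ> gm \<alpha> \<beta> \<delta> \<gamma>"
    by (auto intro!: cvec_eqI simp: fun_eq_iff algebra_simps)
  ultimately show ?thesis
    by (simp add: GLJ_def linear_gm)
qed

lemma GLJ_gm:
  assumes "g \<in> GLJ"
  obtains \<alpha> \<beta> \<delta> \<gamma> where "g = gm \<alpha> \<beta> \<delta> \<gamma>" "\<alpha> * \<gamma> - \<delta> * \<beta> \<noteq> 0"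
proof
  let ?\<alpha> = "c1 (g (cvec 1 0))" and ?\<beta> = "c2 (g (cvec 1 0))"
    and ?\<delta> = "c1 (g (cvec 0 1))" and ?\<gamma> = "c2 (g (cvec 0 1))"
  from assms have g: "linear g" "bij g" "\<And>X. g (Jcn X) = Jcn (g X)"
    by (auto simp: GLJ_def fun_eq_iff)
  show geq: "g = gm ?\<alpha> ?\<beta> ?\<delta> ?\<gamma>"
  proof
    fix X
    have i: "cvec \<i> 0 = Jcn (cvec 1 0)" "cvec 0 \<i> = Jcn (cvec 0 1)"
      by (auto intro!: cvec_eqI)
    have "X = Re (c1 X) *\<^sub>R cvec 1 0 + Im (c1 X) *\<^sub>R cvec \<i> 0
        + Re (c2 X) *\<^sub>R cvec 0 1 + Im (c2 X) *\<^sub>R cvec 0 \<i>"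
      by (auto intro!: cvec_eqI simp: complex_eq_iff)
    then have "g X = g (Re (c1 X) *\<^sub>R cvec 1 0 + Im (c1 X) *\<^sub>R cvec \<i> 0
        + Re (c2 X) *\<^sub>R cvec 0 1 + Im (c2 X) *\<^sub>R cvec 0 \<i>)"
      by (rule arg_cong)
    also have "\<dots> = gm ?\<alpha> ?\<beta> ?\<delta> ?\<gamma> X"
      unfolding i linear_add[OF g(1)] linear_scale[OF g(1)] g(3)
      by (auto intro!: cvec_eqI simp: complex_eq_iff algebra_simps)
    finally show "g X = gm ?\<alpha> ?\<beta> ?\<delta> ?\<gamma> X" .
  qed
  show "?\<alpha> * ?\<gamma> - ?\<delta> * ?\<beta> \<noteq> 0"
  proof
    assume D: "?\<alpha> * ?\<gamma> - ?\<delta> * ?\<beta> = 0"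
    have inj: "X = 0" if "g X = 0" for X
      using that g(1,2) by (metis bij_def injD linear_0)
    \<comment> \<open>These are, up to sign, the columns of the adjugate matrix. A vanishing
      determinant puts them in the kernel, so injectivity makes all four entries zero.\<close>
    have "g (cvec ?\<gamma> (- ?\<beta>)) = 0" "g (cvec ?\<delta> (- ?\<alpha>)) = 0"
      using D by (subst geq, auto intro!: cvec_eqI simp: algebra_simps)+
    then have "cvec ?\<gamma> (- ?\<beta>) = 0" "cvec ?\<delta> (- ?\<alpha>) = 0"
      using inj by blast+
    then have "g (cvec 1 0) = 0"
      by (auto intro!: cvec_eqI)
    from inj[OF this] show False
      by (metis c_cvec(1) c_linear(9) zero_neq_one)
  qed
qed

lemma GLJ_inv: "g \<in> GLJ \<Longrightarrow> inv g \<in> GLJ"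
proof -
  assume g: "g \<in> GLJ"
  then obtain \<alpha> \<beta> \<delta> \<gamma> where M: "g = gm \<alpha> \<beta> \<delta> \<gamma>" "\<alpha> * \<gamma> - \<delta> * \<beta> \<noteq> 0"
    by (rule GLJ_gm)
  let ?D = "\<alpha> * \<gamma> - \<delta> * \<beta>"
  have "inv g = gm (\<gamma> / ?D) (- \<beta> / ?D) (- \<delta> / ?D) (\<alpha> / ?D)"
    unfolding M(1) by (rule inv_equality) (use gm_inverse[OF refl M(2)] in auto)
  moreover have "\<gamma> / ?D * (\<alpha> / ?D) - - \<delta> / ?D * (- \<beta> / ?D) = 1 / ?D"
    using M(2) by (simp add: divide_simps) (simp add: algebra_simps)?
  ultimately show ?thesis
    using M(2) by (auto intro!: gm_GLJ)
qed

lemma GLJ_comp: "g \<in> GLJ \<Longrightarrow> h \<in> GLJ \<Longrightarrow> g \<circ> h \<in> GLJ"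
  by (auto simp: GLJ_def linear_compose bij_comp fun_eq_iff)

lemma GLJ_id: "(\<lambda>X. X) \<in> GLJ"
  by (auto simp: GLJ_def linear_iff fun_eq_iff bij_def)

text \<open>The equation \<open>act g \<nu> = \<mu>\<close> freed of \<open>inv g\<close>; in
  coordinates it becomes polynomial in the entries of \<open>g\<close> and their conjugates.\<close>

definition intertw :: "(real^4 \<Rightarrow> real^4) \<Rightarrow> bilin \<Rightarrow> bilin \<Rightarrow> bool" where
  "intertw g \<nu> \<mu> \<longleftrightarrow> (\<forall>X Y. g (\<nu> X Y) = \<mu> (g X) (g Y))"

lemma intertw_act: "g \<in> GLJ \<Longrightarrow> intertw g \<mu> (act g \<mu>)"
  by (auto simp: GLJ_def intertw_def act_apply bij_def)

lemma act_eqI: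
  assumes "g \<in> GLJ" "intertw g \<mu> \<nu>"
  shows "act g \<mu> = \<nu>"
proof (intro blinfun_eqI)
  fix X Y
  have "act g \<mu> X Y = g (\<mu> (inv g X) (inv g Y))"
    using assms by (simp add: GLJ_def act_apply)
  also have "\<dots> = \<nu> X Y"
    using assms by (simp add: GLJ_def intertw_def bij_is_surj surj_f_inv_f)
  finally show "act g \<mu> X Y = \<nu> X Y" .
qed

lemma intertw_inv:
  assumes "g \<in> GLJ" "intertw g \<mu> \<nu>"
  shows "intertw (inv g) \<nu> \<mu>"
  unfolding intertw_def
proof (intro allI)
  fix X Y
  have bij: "bij g" using assms(1) by (simp add: GLJ_def)
  have "g (\<mu> (inv g X) (inv g Y)) = \<nu> X Y"
    using assms(2) bij by (simp add: intertw_def bij_is_surj surj_f_inv_f)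
  then show "inv g (\<nu> X Y) = \<mu> (inv g X) (inv g Y)"
    using bij by (metis bij_inv_eq_iff)
qed

text \<open>The orientation matters for all explicit matrices: \<open>g\<close> leads from the point
  \<open>\<nu>\<close> back to \<open>\<mu>\<close>, so its columns are the basis in which
  \<open>\<mu>\<close> has the structure constants of \<open>\<nu>\<close>.\<close>

lemma orb_iff: "\<nu> \<in> orb \<mu> \<longleftrightarrow> (\<exists>g\<in>GLJ. intertw g \<nu> \<mu>)"
proof
  assume "\<nu> \<in> orb \<mu>"
  then obtain g where "g \<in> GLJ" "\<nu> = act g \<mu>" by (auto simp: orb_def)
  then show "\<exists>g\<in>GLJ. intertw g \<nu> \<mu>"
    using intertw_inv intertw_act GLJ_inv by metis
next
  assume "\<exists>g\<in>GLJ. intertw g \<nu> \<mu>"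
  then obtain g where g: "g \<in> GLJ" "intertw g \<nu> \<mu>" by blast
  then have "act (inv g) \<mu> = \<nu>"
    by (intro act_eqI GLJ_inv intertw_inv)
  then show "\<nu> \<in> orb \<mu>"
    using GLJ_inv[OF g(1)] by (auto simp: orb_def)
qed

lemma orb_refl: "\<mu> \<in> orb \<mu>"
  using GLJ_id by (auto simp: orb_iff intertw_def intro!: bexI[of _ "\<lambda>X. X"])

lemma orb_sym: "\<nu> \<in> orb \<mu> \<Longrightarrow> \<mu> \<in> orb \<nu>"
  unfolding orb_iff by (meson GLJ_inv intertw_inv)

lemma orb_trans: "\<nu> \<in> orb \<mu> \<Longrightarrow> \<rho> \<in> orb \<nu> \<Longrightarrow> \<rho> \<in> orb \<mu>"
proof -
  assume "\<nu> \<in> orb \<mu>" "\<rho> \<in> orb \<nu>"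
  then obtain g h where "g \<in> GLJ" "intertw g \<nu> \<mu>" "h \<in> GLJ" "intertw h \<rho> \<nu>"
    by (auto simp: orb_iff)
  then show ?thesis
    by (auto simp: orb_iff intertw_def intro!: bexI[of _ "g \<circ> h"] GLJ_comp)
qed

lemma orb_eq: "\<nu> \<in> orb \<mu> \<Longrightarrow> orb \<nu> = orb \<mu>"
  using orb_trans orb_sym by blast

lemma continuous_on_act:
  assumes "g \<in> GLJ"
  shows "continuous_on S (act g)"
proof (rule continuous_on_bilin)
  fix X Y
  have g: "linear g" "bij g" using assms by (auto simp: GLJ_def)
  show "continuous_on S (\<lambda>\<mu>. act g \<mu> X Y)"
    unfolding act_apply[OF g]
    by (intro continuous_on_compose2[OF linear_continuous_on[of g UNIV]] continuous_intros)
      (use g in \<open>auto simp: linear_conv_bounded_linear\<close>)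
qed

text \<open>Each \<open>act g\<close> is continuous and maps the orbit into itself, hence also its
  closure. Closures are therefore unions of orbits, and degeneration is transitive.\<close>

lemma closure_orb_trans:
  assumes "\<nu> \<in> closure (orb \<mu>)" "\<rho> \<in> closure (orb \<nu>)"
  shows "\<rho> \<in> closure (orb \<mu>)"
proof -
  have "orb \<nu> \<subseteq> closure (orb \<mu>)"
  proof
    fix \<kappa> assume "\<kappa> \<in> orb \<nu>"
    then obtain g where g: "g \<in> GLJ" "\<kappa> = act g \<nu>" by (auto simp: orb_def)
    have "act g ` orb \<mu> \<subseteq> orb \<mu>"
    proof
      fix \<kappa>' assume "\<kappa>' \<in> act g ` orb \<mu>"
      then obtain \<mu>' where "\<mu>' \<in> orb \<mu>" "\<kappa>' = act g \<mu>'" by blast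
      then show "\<kappa>' \<in> orb \<mu>"
        using g(1) orb_trans[of \<mu>' \<mu> \<kappa>'] by (simp add: orb_def)
    qed
    then have "act g ` closure (orb \<mu>) \<subseteq> closure (orb \<mu>)"
      by (intro image_closure_subset continuous_on_act[OF g(1)] closed_closure
          order_trans[OF _ closure_subset])
    then show "\<kappa> \<in> closure (orb \<mu>)"
      using assms(1) g(2) by blast
  qed
  then have "closure (orb \<nu>) \<subseteq> closure (orb \<mu>)"
    by (rule closure_minimal) (rule closed_closure)
  then show ?thesis
    using assms(2) by (rule subsetD)
qed

section \<open>Orbits and closures in terms of structure constants\<close>

text \<open>
  With \<open>M\<close> the matrix with columns \<open>(\<alpha>, \<beta>)\<close>, \<open>(\<delta>, \<gamma>)\<close>, \<open>gmL\<close> gives the structure constants of \<open>M \<circ> \<mu>\<close>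
  and \<open>gmR\<close> those of \<open>\<mu> (M _) (M _)\<close>; this avoids inverting \<open>M\<close>.
\<close>

fun gmL :: "complex \<Rightarrow> complex \<Rightarrow> complex \<Rightarrow> complex \<Rightarrow> par \<Rightarrow> par" where
  "gmL \<alpha> \<beta> \<delta> \<gamma> (a1, a2, p1, p2, q1, q2, r1, r2, s1, s2) =
    (\<alpha> * a1 + \<delta> * a2, \<beta> * a1 + \<gamma> * a2, \<alpha> * p1 + \<delta> * p2, \<beta> * p1 + \<gamma> * p2,
     \<alpha> * q1 + \<delta> * q2, \<beta> * q1 + \<gamma> * q2, \<alpha> * r1 + \<delta> * r2, \<beta> * r1 + \<gamma> * r2,
     \<alpha> * s1 + \<delta> * s2, \<beta> * s1 + \<gamma> * s2)"

fun gmR :: "complex \<Rightarrow> complex \<Rightarrow> complex \<Rightarrow> complex \<Rightarrow> par \<Rightarrow> par" where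
  "gmR \<alpha> \<beta> \<delta> \<gamma> (a1, a2, p1, p2, q1, q2, r1, r2, s1, s2) =
    ((\<alpha> * \<gamma> - \<delta> * \<beta>) * a1, (\<alpha> * \<gamma> - \<delta> * \<beta>) * a2,
     cnj \<alpha> * \<alpha> * p1 + cnj \<alpha> * \<beta> * q1 + cnj \<beta> * \<alpha> * r1 + cnj \<beta> * \<beta> * s1,
     cnj \<alpha> * \<alpha> * p2 + cnj \<alpha> * \<beta> * q2 + cnj \<beta> * \<alpha> * r2 + cnj \<beta> * \<beta> * s2,
     cnj \<alpha> * \<delta> * p1 + cnj \<alpha> * \<gamma> * q1 + cnj \<beta> * \<delta> * r1 + cnj \<beta> * \<gamma> * s1,
     cnj \<alpha> * \<delta> * p2 + cnj \<alpha> * \<gamma> * q2 + cnj \<beta> * \<delta> * r2 + cnj \<beta> * \<gamma> * s2,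
     cnj \<delta> * \<alpha> * p1 + cnj \<delta> * \<beta> * q1 + cnj \<gamma> * \<alpha> * r1 + cnj \<gamma> * \<beta> * s1,
     cnj \<delta> * \<alpha> * p2 + cnj \<delta> * \<beta> * q2 + cnj \<gamma> * \<alpha> * r2 + cnj \<gamma> * \<beta> * s2,
     cnj \<delta> * \<delta> * p1 + cnj \<delta> * \<gamma> * q1 + cnj \<gamma> * \<delta> * r1 + cnj \<gamma> * \<gamma> * s1,
     cnj \<delta> * \<delta> * p2 + cnj \<delta> * \<gamma> * q2 + cnj \<gamma> * \<delta> * r2 + cnj \<gamma> * \<gamma> * s2)"

lemma gmL_apply: "gm \<alpha> \<beta> \<delta> \<gamma> (br x X Y) = br (gmL \<alpha> \<beta> \<delta> \<gamma> x) X Y"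
  by (cases x rule: par_cases) (auto intro!: cvec_eqI simp: Let_def algebra_simps)

lemma gmR_apply: "br x (gm \<alpha> \<beta> \<delta> \<gamma> X) (gm \<alpha> \<beta> \<delta> \<gamma> Y) = br (gmR \<alpha> \<beta> \<delta> \<gamma> x) X Y"
  by (cases x rule: par_cases) (auto intro!: cvec_eqI simp: Let_def algebra_simps)

lemma intertw_br: "intertw (gm \<alpha> \<beta> \<delta> \<gamma>) (br x') (br x) \<longleftrightarrow> gmL \<alpha> \<beta> \<delta> \<gamma> x' = gmR \<alpha> \<beta> \<delta> \<gamma> x"
  unfolding intertw_def gmL_apply gmR_apply br_inject[symmetric]
  by (auto simp del: br_apply intro!: blinfun_eqI)

lemma orb_br_iff:
  "br x' \<in> orb (br x) \<longleftrightarrow>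
    (\<exists>\<alpha> \<beta> \<delta> \<gamma>. \<alpha> * \<gamma> - \<delta> * \<beta> \<noteq> 0 \<and> gmL \<alpha> \<beta> \<delta> \<gamma> x' = gmR \<alpha> \<beta> \<delta> \<gamma> x)"
  unfolding orb_iff intertw_br[symmetric] by (metis GLJ_gm gm_GLJ)

text \<open>In explicit instantiations the matrix entries come in the order \<open>\<alpha>\<close>,
  \<open>\<gamma>\<close>, \<open>\<delta>\<close>, \<open>\<beta>\<close>, the diagonal
  first.\<close>

lemma orb_brI:
  "\<alpha> * \<gamma> - \<delta> * \<beta> \<noteq> 0 \<Longrightarrow> gmL \<alpha> \<beta> \<delta> \<gamma> x' = gmR \<alpha> \<beta> \<delta> \<gamma> x \<Longrightarrow> br x' \<in> orb (br x)"
  unfolding orb_br_iff by blast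

text \<open>
  The structure constants in the basis \<open>\<alpha> u + \<beta> v\<close>, \<open>\<gamma> v\<close>, where \<open>u\<close>, \<open>v\<close> is the standard basis of \<open>\<complex>\<^sup>2\<close>
  (meaningful only for \<open>\<alpha> \<noteq> 0\<close> and \<open>\<gamma> \<noteq> 0\<close>).
\<close>

fun tri :: "complex \<Rightarrow> complex \<Rightarrow> complex \<Rightarrow> par \<Rightarrow> par" where
  "tri \<alpha> \<beta> \<gamma> (a1, a2, p1, p2, q1, q2, r1, r2, s1, s2) =
    (let P1 = cnj \<alpha> * \<alpha> * p1 + cnj \<alpha> * \<beta> * q1 + cnj \<beta> * \<alpha> * r1 + cnj \<beta> * \<beta> * s1;
         P2 = cnj \<alpha> * \<alpha> * p2 + cnj \<alpha> * \<beta> * q2 + cnj \<beta> * \<alpha> * r2 + cnj \<beta> * \<beta> * s2;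
         Q1 = cnj \<alpha> * \<gamma> * q1 + cnj \<beta> * \<gamma> * s1; Q2 = cnj \<alpha> * \<gamma> * q2 + cnj \<beta> * \<gamma> * s2;
         R1 = cnj \<gamma> * \<alpha> * r1 + cnj \<gamma> * \<beta> * s1; R2 = cnj \<gamma> * \<alpha> * r2 + cnj \<gamma> * \<beta> * s2;
         S1 = cnj \<gamma> * \<gamma> * s1; S2 = cnj \<gamma> * \<gamma> * s2
     in (\<gamma> * a1, \<alpha> * a2 - \<beta> * a1, P1 / \<alpha>, (P2 - \<beta> * P1 / \<alpha>) / \<gamma>,
         Q1 / \<alpha>, (Q2 - \<beta> * Q1 / \<alpha>) / \<gamma>, R1 / \<alpha>, (R2 - \<beta> * R1 / \<alpha>) / \<gamma>,
         S1 / \<alpha>, (S2 - \<beta> * S1 / \<alpha>) / \<gamma>))"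

lemma gmL_tri:
  assumes "\<alpha> \<noteq> 0" "\<gamma> \<noteq> 0"
  shows "gmL \<alpha> \<beta> 0 \<gamma> (tri \<alpha> \<beta> \<gamma> x) = gmR \<alpha> \<beta> 0 \<gamma> x"
proof -
  have "\<alpha> * (x / \<alpha>) = x" "\<beta> * (x / \<alpha>) + \<gamma> * ((y - \<beta> * x / \<alpha>) / \<gamma>) = y" for x y
    using assms by (auto simp: field_simps)
  then show ?thesis
    by (cases x rule: par_cases) (simp add: Let_def del: times_divide_eq_right, simp add: algebra_simps)
qed

lemma orb_tri: "\<alpha> \<noteq> 0 \<Longrightarrow> \<gamma> \<noteq> 0 \<Longrightarrow> br (tri \<alpha> \<beta> \<gamma> x) \<in> orb (br x)"
  by (rule orb_brI[OF _ gmL_tri]) auto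

section \<open>Reduction to triangular changes of basis by compactness of U(2)\<close>

lemma closed_snd_image:
  fixes Z :: "('a::metric_space \<times> 'b::metric_space) set"
  assumes "compact S" "closed Z" "Z \<subseteq> S \<times> UNIV"
  shows "closed (snd ` Z)"
  unfolding closed_sequential_limits
proof (intro allI impI, elim conjE)
  fix f :: "nat \<Rightarrow> 'b" and l
  assume f: "\<forall>n. f n \<in> snd ` Z" "f \<longlonglongrightarrow> l"
  then have "\<forall>n. \<exists>k. (k, f n) \<in> Z" by force
  then obtain k where k: "\<And>n. (k n, f n) \<in> Z" by metis
  then have "\<forall>n. k n \<in> S" using assms(3) by blast
  then obtain k0 r where r: "k0 \<in> S" "strict_mono r" "(k \<circ> r) \<longlonglongrightarrow> k0"
    using assms(1) unfolding compact_def by metis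
  have "(\<lambda>n. (k (r n), f (r n))) \<longlonglongrightarrow> (k0, l)"
    using r(3) LIMSEQ_subseq_LIMSEQ[OF f(2) r(2)] by (intro tendsto_Pair) (auto simp: o_def)
  then have "(k0, l) \<in> Z"
    by (rule closed_sequentially[OF assms(2), rotated]) (rule k)
  then show "l \<in> snd ` Z" by force
qed

text \<open>Primed letters stand for complex conjugates; as independent variables they leave purely
  polynomial identities.\<close>

lemma unitary_algebra:
  fixes k1 k1' :: complex
  assumes "k1' * k1 + k2' * k2 = 1" "w' * w = 1"
  shows "k1' * (k1 * x + k2 * y) + - w' * k2 * (- w * k2' * x + w * k1' * y) = x"
    "k2' * (k1 * x + k2 * y) + w' * k1 * (- w * k2' * x + w * k1' * y) = y"
    "k1 * (k1' * x + - w' * k2 * y) + k2 * (k2' * x + w' * k1 * y) = x"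
    "- w * k2' * (k1' * x + - w' * k2 * y) + w * k1' * (k2' * x + w' * k1 * y) = y"
  using assms by algebra+

text \<open>Second row of the factorisation triangular times unitary. The first coefficient is the
  Hermitian product of the two rows divided by the length \<open>n\<close> of the first; the
  orthogonal rest has length \<open>N / n\<close>, with \<open>N\<close> the modulus of the
  determinant \<open>D\<close>, whose phase \<open>D / N\<close> goes into the unitary
  factor.\<close>

lemma gram_schmidt_algebra:
  fixes \<alpha> :: complex
  assumes "n * n = \<alpha>' * \<alpha> + \<delta>' * \<delta>" "n \<noteq> 0" "N \<noteq> 0" "D = \<alpha> * \<gamma> - \<delta> * \<beta>"
  shows "(\<beta> * \<alpha>' + \<gamma> * \<delta>') / n * (\<alpha> / n * x + \<delta> / n * y)
    + N / n * (- (D / N) * (\<delta>' / n) * x + D / N * (\<alpha>' / n) * y) = \<beta> * x + \<gamma> * y" (is "?l = _")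
proof -
  have "?l = ((\<beta> * \<alpha>' + \<gamma> * \<delta>') * (\<alpha> * x + \<delta> * y) + D * (\<alpha>' * y - \<delta>' * x)) / (n * n)"
    using assms(2,3) by (simp add: field_simps)
  also have "(\<beta> * \<alpha>' + \<gamma> * \<delta>') * (\<alpha> * x + \<delta> * y) + D * (\<alpha>' * y - \<delta>' * x) = (\<beta> * x + \<gamma> * y) * (n * n)"
    unfolding assms(1,4) by algebra
  finally show ?thesis using assms(2) by simp
qed

text \<open>
  By the Gram-Schmidt process every element of \<open>GLJ\<close> is the product of a lower triangular matrix
  with positive diagonal and a unitary one, and the unitary group is compact.
\<close>

lemma closure_orb_tri:
  assumes Q: "closed Q"
    and tri: "\<And>\<alpha> \<beta> \<gamma>. \<alpha> > 0 \<Longrightarrow> \<gamma> > 0 \<Longrightarrow> tri (complex_of_real \<alpha>) \<beta> (complex_of_real \<gamma>) x \<in> Q"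
    and \<nu>: "\<nu> \<in> closure (orb (br x))"
  obtains x' where "x' \<in> Q" "\<nu> \<in> orb (br x')"
proof -
  \<comment> \<open>Coordinates of U(2): the first row is a point of the 3-sphere and
    \<open>w\<close> is the determinant. \<open>K'\<close> below is the conjugate transpose.\<close>
  define U :: "((complex \<times> complex) \<times> complex) set" where "U = sphere 0 1 \<times> sphere 0 1"
  define K where "K = (\<lambda>((k1, k2), w). gm k1 (- w * cnj k2) k2 (w * cnj k1))"
  define K' where "K' = (\<lambda>((k1, k2), w). gm (cnj k1) (cnj k2) (- cnj w * k2) (cnj w * k1))"
  have U: "cnj k1 * k1 + cnj k2 * k2 = 1 \<and> cnj w * w = 1" if "((k1, k2), w) \<in> U" for k1 k2 w
  proof -
    have "(norm k1)\<^sup>2 + (norm k2)\<^sup>2 = 1" "norm w = 1"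
      using that by (auto simp: U_def norm_Pair)
    then show ?thesis
      by (simp add: mult.commute[of "cnj _"] complex_norm_square[symmetric] flip: of_real_add of_real_power)
  qed
  have K'K: "K' k (K k X) = X" and KK': "K k (K' k X) = X" and KG: "K k \<in> GLJ" if "k \<in> U" for k X
  proof -
    obtain k1 k2 w where k: "k = ((k1, k2), w)" by (metis surj_pair)
    note u = U[OF that[unfolded k]]
    show "K' k (K k X) = X"
      using unitary_algebra(1,2)[of "cnj k1" k1 "cnj k2" k2 "cnj w" w] u
      by (auto simp: k K_def K'_def intro!: cvec_eqI)
    show "K k (K' k X) = X"
      using unitary_algebra(3,4)[of "cnj k1" k1 "cnj k2" k2 "cnj w" w] u
      by (auto simp: k K_def K'_def intro!: cvec_eqI)
    have "k1 * (w * cnj k1) - k2 * (- w * cnj k2) = w * (cnj k1 * k1 + cnj k2 * k2)"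
      by (simp add: algebra_simps)
    also have "\<dots> \<noteq> 0" using u by auto
    finally show "K k \<in> GLJ" unfolding k K_def by (auto intro: gm_GLJ)
  qed
  define Z where "Z = (U \<times> UNIV) \<inter> (\<lambda>(k, \<nu>). act (K k) \<nu>) -` (br ` Q)"
  have invK: "inv (K k) = K' k" if "k \<in> U" for k
    using K'K[OF that] KK'[OF that] by (auto intro!: inv_equality)
  have cU: "compact U" by (auto simp: U_def intro!: compact_Times)
  have "closed Z"
    unfolding Z_def
  proof (rule continuous_closed_preimage)
    show "continuous_on (U \<times> UNIV) (\<lambda>(k, \<nu>). act (K k) \<nu>)"
    proof (rule continuous_on_bilin)
      fix X Y
      \<comment> \<open>The explicit inverse \<open>K'\<close> makes the action jointly continuous
        in the matrix and the bracket.\<close>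
      have "continuous_on (U \<times> UNIV) (\<lambda>(k, \<nu> :: bilin). K k (\<nu> (K' k X) (K' k Y)))"
        unfolding K_def K'_def gm_def case_prod_beta by (intro continuous_intros)
      then show "continuous_on (U \<times> UNIV) (\<lambda>z. (case z of (k, \<nu>) \<Rightarrow> act (K k) \<nu>) X Y)"
        by (rule continuous_on_eq) (use KG invK in \<open>auto simp: GLJ_def act_apply\<close>)
    qed
    show "closed (U \<times> UNIV :: (((complex \<times> complex) \<times> complex) \<times> bilin) set)"
      by (intro closed_Times closed_UNIV compact_imp_closed cU)
    show "closed (br ` Q)" using Q by (rule closed_br_image)
  qed
  then have "closed (snd ` Z)"
    by (rule closed_snd_image[OF cU]) (auto simp: Z_def)
  moreover have "orb (br x) \<subseteq> snd ` Z"
  proof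
    fix \<nu> assume "\<nu> \<in> orb (br x)"
    then obtain \<alpha> \<beta> \<delta> \<gamma> where D: "\<alpha> * \<gamma> - \<delta> * \<beta> \<noteq> 0" and tw: "intertw (gm \<alpha> \<beta> \<delta> \<gamma>) \<nu> (br x)"
      unfolding orb_iff by (metis GLJ_gm)
    define n where "n = norm (\<alpha>, \<delta>)"
    define D' where "D' = \<alpha> * \<gamma> - \<delta> * \<beta>"
    define k where "k = ((\<alpha> / of_real n, \<delta> / of_real n), D' / of_real (norm D'))"
    have "n \<noteq> 0" using D by (auto simp: n_def zero_prod_def)
    then have n: "n > 0" by (simp add: n_def)
    have D': "norm D' > 0" using D by (simp add: D'_def)
    have n2: "complex_of_real n * complex_of_real n = cnj \<alpha> * \<alpha> + cnj \<delta> * \<delta>"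
    proof -
      have "n * n = (norm \<alpha>)\<^sup>2 + (norm \<delta>)\<^sup>2"
        by (simp add: n_def norm_Pair flip: power2_eq_square)
      then have "complex_of_real (n * n) = of_real ((norm \<alpha>)\<^sup>2) + of_real ((norm \<delta>)\<^sup>2)"
        by (metis of_real_add)
      then show ?thesis
        unfolding complex_norm_square by (simp add: mult.commute)
    qed
    have k: "k \<in> U"
      using n D' by (auto simp: U_def k_def norm_Pair n_def norm_divide power_divide
         simp flip: add_divide_distrib)
    define B where "B = gm (of_real n) ((\<beta> * cnj \<alpha> + \<gamma> * cnj \<delta>) / of_real n) 0 (of_real (norm D' / n))"
    have BK: "B (K k X) = gm \<alpha> \<beta> \<delta> \<gamma> X" for X
      using gram_schmidt_algebra[OF n2 _ _ D'_def, where N = "of_real (norm D')"] n D'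
      by (intro cvec_eqI) (simp_all add: B_def K_def k_def distrib_left)
    define x' where "x' = tri (of_real n) ((\<beta> * cnj \<alpha> + \<gamma> * cnj \<delta>) / of_real n) (of_real (norm D' / n)) x"
    have "intertw B (br x') (br x)"
      unfolding B_def x'_def intertw_br using n D' by (intro gmL_tri) auto
    have "act (K k) \<nu> = br x'"
    proof (rule act_eqI[OF KG[OF k]], unfold intertw_def, intro allI)
      fix X Y
      have "B (K k (\<nu> X Y)) = B (br x' (K k X) (K k Y))"
        using tw \<open>intertw B (br x') (br x)\<close> unfolding intertw_def BK by (simp add: BK)
      moreover have "inj B"
        using gm_GLJ[of "of_real n" "of_real (norm D' / n)" 0] n D'
        by (auto simp: B_def GLJ_def bij_def)
      ultimately show "K k (\<nu> X Y) = br x' (K k X) (K k Y)"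
        by (simp add: inj_eq)
    qed
    moreover have "x' \<in> Q" unfolding x'_def using n D' by (intro tri) auto
    ultimately have "(k, \<nu>) \<in> Z" using k by (auto simp: Z_def)
    then show "\<nu> \<in> snd ` Z" by force
  qed
  ultimately have "\<nu> \<in> snd ` Z"
    using \<nu> by (meson closure_minimal subsetD)
  then obtain k x' where "k \<in> U" "act (K k) \<nu> = br x'" "x' \<in> Q"
    by (auto simp: Z_def)
  moreover from KG[OF \<open>k \<in> U\<close>] have "act (K k) \<nu> \<in> orb \<nu>"
    unfolding orb_def by (rule imageI)
  ultimately have "br x' \<in> orb \<nu>" by simp
  with \<open>x' \<in> Q\<close> show ?thesis
    using that orb_sym by blast
qed

text \<open>
  \<open>Ipar\<close> covers the brackets for which the complex line through \<open>e 2\<close> is an abelian ideal, \<open>Wpar\<close>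
  the family \<open>\<mu>\<^sub>8\<close> and, after exchanging the two complex coordinates, \<open>\<mu>\<^sub>1\<^sub>1\<close> and \<open>\<mu>\<^sub>1\<^sub>3\<close>, for which
  \<open>Xpar\<close> is the form in the list.
\<close>

definition Ipar :: "complex \<Rightarrow> complex \<Rightarrow> complex \<Rightarrow> complex \<Rightarrow> complex \<Rightarrow> par" where
  "Ipar A B R P p = (0, A, P, p, 0, B, 0, R, 0, 0)"

definition Wpar :: "complex \<Rightarrow> complex \<Rightarrow> par" where
  "Wpar c k = (- c / 2, 0, 0, k / 2, 0, 0, c / 2, 0, 0, of_real (Re c))"

definition Xpar :: "complex \<Rightarrow> par" where
  "Xpar c = (0, c / 2, of_real (Re c), 0, 0, c / 2, 0, 0, 1 / 2, 0)"

fun prm :: "mu_name \<Rightarrow> par" where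
  "prm Mu0 = Ipar 0 0 0 0 0"
| "prm Mu1 = Ipar 0 0 0 0 (- \<i> / 2)"
| "prm Mu2 = (0, 0, 1 / 2, 0, 0, 0, 0, 0, 0, 1 / 2)"
| "prm (Mu3 a b) = Ipar (Complex (1 - b) a / 2) (Complex (1 + b) (- a) / 2) 0 0 0"
| "prm Mu4 = (0, 0, 1 / 2, 0, 0, 1 / 2, 0, 1 / 2, - 1 / 2, 0)"
| "prm Mu5 = Ipar 1 0 0 0 (1 / 2)"
| "prm (Mu6 a b) = Ipar (Complex a b / 2) (Complex a b / 2) 0 (1 / 2) 0"
| "prm (Mu7 a) = Ipar (Complex a 1 / 2) (Complex a 1 / 2) 0 0 0"
| "prm (Mu8p a) = Wpar (- \<i>) (Complex a 1)"
| "prm (Mu8m a) = Wpar (- \<i>) (Complex a (- 1))"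
| "prm Mu9 = Ipar (1 / 2) (1 / 2) 0 (1 / 2) (1 / 2)"
| "prm (Mu10 a) = Ipar (of_real (a - 1) / 2) (of_real a / 2) (1 / 2) (1 / 2) 0"
| "prm Mu11p = Xpar (1 / 2)"
| "prm Mu11m = Xpar (- 1 / 2)"
| "prm Mu12 = Ipar (- 1 / 2) 0 (1 / 2) (1 / 2) (1 / 2)"
| "prm (Mu13p a) = Xpar (Complex a 1)"
| "prm (Mu13m a) = Xpar (Complex a (- 1))"
| "prm Mu14 = Ipar (1 / 2) 1 (1 / 2) (1 / 2) (- \<i> / 2)"

lemmas par_defs = Ipar_def Wpar_def Xpar_def

lemma bracket_br: "bracket x = br (prm x)"
proof (intro blinfun_eqI)
  fix X Y
  have "Re (c1 Z) = Z $ 1" "Im (c1 Z) = Z $ 3" "Re (c2 Z) = Z $ 2" "Im (c2 Z) = Z $ 4" for Z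
    by (auto simp: c1_def c2_def)
  note [simp] = this
  show "bracket x X Y = br (prm x) X Y"
    by (cases x; simp add: table_apply vec_eq_iff forall_4 par_defs Let_def axis_def field_simps zero_blinfun.rep_eq)
qed

text \<open>Alternation and integrability are built into \<open>brf\<close>; only the Jacobi
  identity remains.\<close>

lemma br_LJ:
  assumes "\<And>X Y Z. brf x (brf x X Y) Z + brf x (brf x Y Z) X + brf x (brf x Z X) Y = 0"
  shows "br x \<in> LJ"
proof -
  have "br x X X = 0" for X
    by (cases x rule: par_cases) (simp add: Let_def algebra_simps)
  moreover have "br x X Y - br x (Jcn X) (Jcn Y) + Jcn (br x (Jcn X) Y) + Jcn (br x X (Jcn Y)) = 0" for X Y
    by (cases x rule: par_cases) (auto intro!: cvec_eqI simp: Let_def algebra_simps)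
  ultimately show ?thesis
    using assms by (simp add: LJ_def)
qed

lemma bracket_LJ: "bracket x \<in> LJ"
  unfolding bracket_br
  by (rule br_LJ, rule cvec_eqI; cases x; simp add: par_defs Let_def del: Complex_eq)
    (simp_all add: algebra_simps add_divide_distrib diff_divide_distrib complex_eq_iff)

section \<open>Closures of the orbits in the list\<close>

declare bracket.simps(2-) [simp del]

section \<open>Brackets with an abelian ideal through the second basis vector\<close>

lemma orb_Ipar:
  assumes "\<alpha> \<noteq> 0" "\<gamma> \<noteq> 0" "A' = \<alpha> * A" "P' = cnj \<alpha> * P" "B' = cnj \<alpha> * B" "R' * \<gamma> = \<alpha> * R * cnj \<gamma>"
    and "p' * \<gamma> = \<alpha> * cnj \<alpha> * p + cnj \<alpha> * \<beta> * (B - P) + \<alpha> * cnj \<beta> * R"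
  shows "br (Ipar A' B' R' P' p') \<in> orb (br (Ipar A B R P p))"
  using assms by (intro orb_brI[of \<alpha> \<gamma> 0 \<beta>]) (auto simp: Ipar_def algebra_simps)

lemma br_0: "br (Ipar 0 0 0 0 0) = 0"
  using bracket_br[of Mu0] by simp

lemma Ipar_0_cases: "br (Ipar 0 0 0 0 p) = 0 \<or> br (Ipar 0 0 0 0 p) \<in> orb (bracket Mu1)"
proof (cases "p = 0")
  case False
  then have "br (Ipar 0 0 0 0 p) \<in> orb (br (prm Mu1))"
    unfolding prm.simps
    by (intro orb_Ipar[of 1 "- \<i> / (2 * p)" _ _ _ _ _ _ _ _ _ _ 0]) auto
  then show ?thesis by (simp add: bracket_br)
qed (simp add: br_0)

lemma orb_0: "orb 0 = {0}"
proof -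
  have "act g 0 = 0" if "g \<in> GLJ" for g
    using that by (intro act_eqI) (auto simp: intertw_def zero_blinfun.rep_eq linear_0 GLJ_def)
  then show ?thesis using GLJ_id by (auto simp: orb_def)
qed

text \<open>For a positive diagonal, \<open>A\<close>, \<open>B\<close>, \<open>R\<close>,
  \<open>P\<close> are all multiplied by the same \<open>\<alpha>\<close>, which in the limit
  becomes some \<open>t \<ge> 0\<close>. Only \<open>p\<close> moves in a more complicated way;
  \<open>C\<close> is any closed set containing the values it takes.\<close>

lemma closure_Ipar:
  assumes C: "closed C"
    and tri: "\<And>\<alpha> \<beta> \<gamma>. \<alpha> > 0 \<Longrightarrow> \<gamma> > 0 \<Longrightarrow>
      (complex_of_real (\<alpha> * \<alpha>) * p + of_real \<alpha> * \<beta> * (B - P) + of_real \<alpha> * cnj \<beta> * R) / complex_of_real \<gamma> \<in> C"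
    and \<nu>: "\<nu> \<in> closure (orb (br (Ipar A B R P p)))"
  obtains t \<pi> where "t \<ge> 0" "\<pi> \<in> C"
    "\<nu> \<in> orb (br (Ipar (of_real t * A) (of_real t * B) (of_real t * R) (of_real t * P) \<pi>))"
proof -
  define L where "L = (\<lambda>(t, \<pi>). Ipar (of_real t * A) (of_real t * B) (of_real t * R) (of_real t * P) \<pi>)"
  have "closed (L ` ({0..} \<times> C))"
  \<comment> \<open>If all four vanish, \<open>t\<close> leaves no trace and \<open>L\<close> is not
    injective, so this case needs its own linear map.\<close>
  proof (cases "A = 0 \<and> B = 0 \<and> R = 0 \<and> P = 0")
    case True
    have "L ` ({0..} \<times> C) = Ipar 0 0 0 0 ` C"
      using True by (force simp: L_def)
    moreover have "linear (Ipar 0 0 0 0)" "inj (Ipar 0 0 0 0)"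
      by (auto intro!: linearI injI simp: Ipar_def)
    ultimately show ?thesis
      using closed_injective_linear_image[OF C] by simp
  next
    case False
    have "linear L"
      by (rule linearI) (auto simp: L_def Ipar_def algebra_simps scaleR_conv_of_real)
    moreover have "inj L"
      using False by (auto intro!: injI simp: L_def Ipar_def)
    moreover have "closed ({0 :: real..} \<times> C)"
      by (intro closed_Times C closed_atLeast)
    ultimately show ?thesis
      by (intro closed_injective_linear_image)
  qed
  then obtain x' where x': "x' \<in> L ` ({0..} \<times> C)" "\<nu> \<in> orb (br x')"
  proof (rule closure_orb_tri[OF _ _ \<nu>])
    fix \<alpha> \<gamma> :: real and \<beta> :: complex
    assume pos: "\<alpha> > 0" "\<gamma> > 0"
    have "tri (of_real \<alpha>) \<beta> (of_real \<gamma>) (Ipar A B R P p) = L (\<alpha>,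
      (of_real (\<alpha> * \<alpha>) * p + of_real \<alpha> * \<beta> * (B - P) + of_real \<alpha> * cnj \<beta> * R) / of_real \<gamma>)"
      using pos by (simp add: L_def Ipar_def Let_def field_simps)
    then show "tri (of_real \<alpha>) \<beta> (of_real \<gamma>) (Ipar A B R P p) \<in> L ` ({0..} \<times> C)"
      using tri[OF pos, of \<beta>] pos by (auto intro!: imageI)
  qed blast
  then obtain t \<pi> where "t \<ge> 0" "\<pi> \<in> C" "x' = L (t, \<pi>)" by auto
  then show ?thesis
    using x'(2) that[of t \<pi>] by (simp add: L_def)
qed

lemma Ipar_0_orb_cases:
  assumes "\<nu> \<in> orb (br (Ipar 0 0 0 0 \<pi>))"
  shows "\<nu> \<in> orb (bracket Mu1) \<or> \<nu> = 0"
  using Ipar_0_cases[of \<pi>] assms orb_trans by (auto simp: orb_0)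

text \<open>As a real-linear map of the plane, the left-hand side has determinant |a|^2 - |b|^2; the
  witness is Cramer's rule.\<close>

lemma solve_cnj:
  assumes "norm a \<noteq> norm b"
  obtains \<beta> where "a * \<beta> + b * cnj \<beta> = y"
proof
  define n where "n = a * cnj a - b * cnj b"
  have n: "n = of_real ((norm a)\<^sup>2 - (norm b)\<^sup>2)"
    by (simp only: n_def of_real_diff complex_norm_square)
  then have "n \<noteq> 0" "cnj n = n"
    using assms by (auto simp: power2_eq_iff_nonneg simp flip: of_real_power)
  then show "a * ((cnj a * y - b * cnj y) / n) + b * cnj ((cnj a * y - b * cnj y) / n) = y"
    by (simp add: field_simps) (simp add: n_def algebra_simps)
qed

text \<open>The shears act on \<open>p\<close> by an invertible real-linear map, so for
  \<open>t \<noteq> 0\<close> any limit value of \<open>p\<close> is reached inside the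
  orbit.\<close>

lemma closure_Ipar_free:
  assumes "norm (B - P) \<noteq> norm R" and \<nu>: "\<nu> \<in> closure (orb (br (Ipar A B R P p)))"
  shows "\<nu> \<in> orb (br (Ipar A B R P p)) \<or> \<nu> \<in> orb (bracket Mu1) \<or> \<nu> = 0"
proof -
  obtain t \<pi> where t: "t \<ge> 0"
    "\<nu> \<in> orb (br (Ipar (of_real t * A) (of_real t * B) (of_real t * R) (of_real t * P) \<pi>))"
    by (rule closure_Ipar[OF closed_UNIV _ \<nu>]) auto
  show ?thesis
  proof (cases "t = 0")
    case True
    then show ?thesis using t Ipar_0_orb_cases by simp
  next
    case False
    obtain \<beta> where "(B - P) * \<beta> + R * cnj \<beta> = (\<pi> - of_real (t * t) * p) / of_real t"
      using solve_cnj[OF assms(1)] .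
    then have "br (Ipar (of_real t * A) (of_real t * B) (of_real t * R) (of_real t * P) \<pi>)
      \<in> orb (br (Ipar A B R P p))"
      using False by (intro orb_Ipar[of "of_real t" 1 _ _ _ _ _ _ _ _ _ _ \<beta>]) (auto simp: field_simps)
    then show ?thesis using t orb_trans by blast
  qed
qed

text \<open>With \<open>B = P\<close> and \<open>R = 0\<close> shears are ineffective, so
  \<open>p\<close> stays 0 and \<mu>_1 never appears. Instances are \<open>Mu3 0 (-1)\<close> and
  \<open>Mu6 1 0\<close>.\<close>

lemma closure_Ipar_rigid:
  assumes \<nu>: "\<nu> \<in> closure (orb (br (Ipar A P 0 P 0)))"
  shows "\<nu> \<in> orb (br (Ipar A P 0 P 0)) \<or> \<nu> = 0"
proof -
  obtain t \<pi> where t: "t \<ge> 0" "\<pi> \<in> {0}"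
    "\<nu> \<in> orb (br (Ipar (of_real t * A) (of_real t * P) (of_real t * 0) (of_real t * P) \<pi>))"
    by (rule closure_Ipar[OF _ _ \<nu>, of "{0}"]) auto
  show ?thesis
  proof (cases "t = 0")
    case True
    then show ?thesis using t by (simp add: br_0 orb_0)
  next
    case False
    have "br (Ipar (of_real t * A) (of_real t * P) (of_real t * 0) (of_real t * P) \<pi>)
      \<in> orb (br (Ipar A P 0 P 0))"
      using False t by (intro orb_Ipar[of "of_real t" 1]) auto
    then show ?thesis using t orb_trans by blast
  qed
qed

text \<open>Shears are again ineffective, but a nonzero \<open>p\<close> can be rescaled freely by
  \<open>\<gamma>\<close>; only its vanishing in the limit leads to a new orbit with
  \<open>t \<noteq> 0\<close>. Instances are \<open>Mu5\<close> and \<open>Mu9\<close>.\<close>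

lemma closure_Ipar_shear:
  assumes "p \<noteq> 0" and \<nu>: "\<nu> \<in> closure (orb (br (Ipar A P 0 P p)))"
  shows "\<nu> \<in> orb (br (Ipar A P 0 P p)) \<or> \<nu> \<in> orb (br (Ipar A P 0 P 0)) \<or> \<nu> \<in> orb (bracket Mu1) \<or> \<nu> = 0"
proof -
  obtain t \<pi> where t: "t \<ge> 0"
    "\<nu> \<in> orb (br (Ipar (of_real t * A) (of_real t * P) (of_real t * 0) (of_real t * P) \<pi>))"
    by (rule closure_Ipar[OF closed_UNIV _ \<nu>]) auto
  show ?thesis
  proof (cases "t = 0")
    case True
    then show ?thesis using t Ipar_0_orb_cases by simp
  next
    case t0: False
    show ?thesis
    proof (cases "\<pi> = 0")
      case True
      have "br (Ipar (of_real t * A) (of_real t * P) (of_real t * 0) (of_real t * P) \<pi>)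
        \<in> orb (br (Ipar A P 0 P 0))"
        using t0 True by (intro orb_Ipar[of "of_real t" 1]) auto
      then show ?thesis using t orb_trans by blast
    next
      case False
      have "br (Ipar (of_real t * A) (of_real t * P) (of_real t * 0) (of_real t * P) \<pi>)
        \<in> orb (br (Ipar A P 0 P p))"
        using t0 False assms(1)
        by (intro orb_Ipar[of "of_real t" "of_real (t * t) * p / \<pi>" _ _ _ _ _ _ _ _ _ _ 0]) auto
      then show ?thesis using t orb_trans by blast
    qed
  qed
qed

text \<open>
  The members of the family \<open>Ipar\<close> with \<open>B - P = R\<close>: here the shears \<open>u \<mapsto> u + \<beta> v\<close> change \<open>p\<close> only by
  real multiples of \<open>cnj c\<close>.  These are \<open>\<mu>\<^sub>1\<^sub>0(0)\<close>, \<open>\<mu>\<^sub>1\<^sub>0(2)\<close>, \<open>\<mu>\<^sub>1\<^sub>2\<close> and \<open>\<mu>\<^sub>1\<^sub>4\<close>.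
\<close>

definition Vpar :: "complex \<Rightarrow> complex \<Rightarrow> par" where
  "Vpar c p = Ipar (c / 2) (of_real (Re c)) (cnj c / 2) (c / 2) p"

lemma Vpar_diff: "complex_of_real (Re c) - c / 2 = cnj c / 2"
  by (simp add: complex_eq_iff)

lemma Vpar_image:
  "\<alpha> * \<beta> * (cnj c / 2) + \<alpha> * cnj \<beta> * (cnj c / 2) = \<alpha> * cnj c * of_real (Re \<beta>)"
proof -
  have "\<beta> + cnj \<beta> = 2 * of_real (Re \<beta>)"
    by (simp add: complex_eq_iff)
  then have "\<alpha> * cnj c * (\<beta> + cnj \<beta>) = \<alpha> * cnj c * (2 * of_real (Re \<beta>))" by simp
  then show ?thesis by (simp add: field_simps)
qed

lemma closure_Vpar_0:
  assumes c: "c \<noteq> 0" and \<nu>: "\<nu> \<in> closure (orb (br (Vpar c 0)))"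
  shows "\<nu> \<in> orb (br (Vpar c 0)) \<or> \<nu> \<in> orb (bracket Mu1) \<or> \<nu> = 0"
proof -
  \<comment> \<open>The real line through \<open>cnj c\<close>: starting from \<open>p = 0\<close>,
    triangular changes with positive diagonal never leave it.\<close>
  define C where "C = {\<pi>. Im (\<pi> / cnj c) = 0}"
  have "closed C"
    unfolding C_def by (intro closed_Collect_eq continuous_intros) (use c in auto)
  moreover have "(complex_of_real (\<alpha> * \<alpha>) * 0 + of_real \<alpha> * \<beta> * (of_real (Re c) - c / 2)
      + of_real \<alpha> * cnj \<beta> * (cnj c / 2)) / complex_of_real \<gamma> \<in> C" for \<alpha> \<beta> \<gamma>
  proof -
    have "(complex_of_real (\<alpha> * \<alpha>) * 0 + of_real \<alpha> * \<beta> * (of_real (Re c) - c / 2)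
      + of_real \<alpha> * cnj \<beta> * (cnj c / 2)) / complex_of_real \<gamma>
      = cnj c * of_real (\<alpha> * Re \<beta> / \<gamma>)"
      unfolding Vpar_diff mult_zero_right add_0 Vpar_image by simp
    also have "\<dots> \<in> C"
      using c by (simp add: C_def del: of_real_mult of_real_divide)
    finally show ?thesis .
  qed
  ultimately obtain t \<pi> where t: "t \<ge> 0" "\<pi> \<in> C"
    "\<nu> \<in> orb (br (Ipar (of_real t * (c / 2)) (of_real t * of_real (Re c)) (of_real t * (cnj c / 2)) (of_real t * (c / 2)) \<pi>))"
    by (rule closure_Ipar[OF _ _ \<nu>[unfolded Vpar_def]])
  show ?thesis
  proof (cases "t = 0")
    case True
    then show ?thesis using t Ipar_0_orb_cases by simp
  next
    case False
    have "\<pi> = cnj c * of_real (Re (\<pi> / cnj c))"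
      using t(2) c by (simp add: C_def complex_is_Real_iff[symmetric])
    then have "br (Ipar (of_real t * (c / 2)) (of_real t * of_real (Re c)) (of_real t * (cnj c / 2)) (of_real t * (c / 2)) \<pi>)
      \<in> orb (br (Vpar c 0))"
      unfolding Vpar_def
      using False c
      by (intro orb_Ipar[of "of_real t" 1 _ _ _ _ _ _ _ _ _ _ "of_real (Re (\<pi> / cnj c) / t)"])
        (simp_all add: Vpar_diff Vpar_image)
    then show ?thesis using t orb_trans by blast
  qed
qed

lemma closure_Vpar:
  assumes c: "c \<noteq> 0" and p: "Im (p / cnj c) \<noteq> 0" and \<nu>: "\<nu> \<in> closure (orb (br (Vpar c p)))"
  shows "\<nu> \<in> orb (br (Vpar c p)) \<or> \<nu> \<in> orb (br (Vpar c 0)) \<or> \<nu> \<in> orb (bracket Mu1) \<or> \<nu> = 0"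
proof -
  obtain t \<pi> where t: "t \<ge> 0"
    "\<nu> \<in> orb (br (Ipar (of_real t * (c / 2)) (of_real t * of_real (Re c)) (of_real t * (cnj c / 2)) (of_real t * (c / 2)) \<pi>))"
    by (rule closure_Ipar[OF closed_UNIV _ \<nu>[unfolded Vpar_def]]) auto
  have split: "z = cnj c * Complex (Re (z / cnj c)) (Im (z / cnj c))" for z
    using c by simp
  show ?thesis
  proof (cases "t = 0")
    case True
    then show ?thesis using t Ipar_0_orb_cases by simp
  next
    case t0: False
    show ?thesis
    proof (cases "Im (\<pi> / cnj c) = 0")
      case True
      then have "\<pi> = cnj c * of_real (Re (\<pi> / cnj c))"
        using c by (simp add: complex_is_Real_iff[symmetric])
      then have "br (Ipar (of_real t * (c / 2)) (of_real t * of_real (Re c)) (of_real t * (cnj c / 2)) (of_real t * (c / 2)) \<pi>)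
        \<in> orb (br (Vpar c 0))"
        unfolding Vpar_def
        using t0 c
        by (intro orb_Ipar[of "of_real t" 1 _ _ _ _ _ _ _ _ _ _ "of_real (Re (\<pi> / cnj c) / t)"])
          (simp_all add: Vpar_diff Vpar_image)
      then show ?thesis using t orb_trans by blast
    next
      case False
      define x y where "x = \<pi> / cnj c" and "y = p / cnj c"
      \<comment> \<open>With \<open>s\<close> as the second diagonal entry and \<open>b\<close> as
        the shear, these are the imaginary and the real part of the equation
        \<open>x * s = t * t * y + t * b\<close>.\<close>
      define s where "s = t * t * Im y / Im x"
      define b where "b = (s * Re x - t * t * Re y) / t"
      have "Im x \<noteq> 0" "Im y \<noteq> 0" using False p by (simp_all add: x_def y_def)
      then have s: "s \<noteq> 0" using t0 by (simp add: s_def)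
      have "x * of_real s = of_real (t * t) * y + of_real t * of_real b"
        using \<open>Im x \<noteq> 0\<close> t0 by (simp add: complex_eq_iff b_def s_def)
      moreover have xy: "\<pi> = cnj c * x" "p = cnj c * y"
        using c by (simp_all add: x_def y_def)
      ultimately have "\<pi> * of_real s = of_real (t * t) * p + of_real t * cnj c * of_real b"
        by (simp add: xy mult.assoc distrib_left mult.left_commute)
      then have "br (Ipar (of_real t * (c / 2)) (of_real t * of_real (Re c)) (of_real t * (cnj c / 2)) (of_real t * (c / 2)) \<pi>)
        \<in> orb (br (Vpar c p))"
        unfolding Vpar_def
        using t0 s
        by (intro orb_Ipar[of "of_real t" "of_real s" _ _ _ _ _ _ _ _ _ _ "of_real b"])
          (simp_all add: Vpar_diff Vpar_image add.assoc)
      then show ?thesis using t orb_trans by blast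
    qed
  qed
qed

text \<open>The entry \<open>\<pi>\<close> satisfies \<open>2 * \<gamma> * \<pi> = \<alpha> *
  \<alpha> * k + \<beta> * cnj \<beta> * cnj c\<close>. When \<open>\<gamma>\<close> tends to 0
  while \<open>\<beta>\<close> does not, the right-hand side must cancel, which requires
  \<open>k\<close> to be a negative real multiple of \<open>cnj c\<close>. This is the source of the
  extra arrows from \<open>Mu8m 0\<close> to \<open>Mu10 0\<close> and from \<open>Mu11m\<close> to
  \<open>Mu10 2\<close>.\<close>

lemma closure_Wpar:
  assumes c: "c \<noteq> 0" and k: "k \<noteq> 0" and \<nu>: "\<nu> \<in> closure (orb (br (Wpar c k)))"
  shows "\<nu> \<in> orb (br (Wpar c k)) \<or> \<nu> \<in> orb (br (Wpar c 0)) \<or> \<nu> \<in> orb (bracket Mu1) \<or> \<nu> = 0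
    \<or> (\<exists>r<0. k = of_real r * cnj c) \<and> \<nu> \<in> orb (br (Vpar c 0))"
proof -
  define L :: "complex \<times> real \<times> complex \<Rightarrow> par" where "L = (\<lambda>(\<beta>, \<gamma>, \<pi>).
    (- of_real \<gamma> * c / 2, \<beta> * c / 2, cnj \<beta> * c / 2, \<pi>, 0, cnj \<beta> * of_real (Re c),
     of_real \<gamma> * c / 2, \<beta> * cnj c / 2, 0, of_real \<gamma> * of_real (Re c)))"
  \<comment> \<open>No other constant contains the first diagonal entry; \<open>T\<close> recovers
    its square from the parameters.\<close>
  define T where "T = (\<lambda>(\<beta>, \<gamma> :: real, \<pi>). (2 * of_real \<gamma> * \<pi> - \<beta> * cnj \<beta> * cnj c) / k)"
  define C where "C = {x :: complex \<times> real \<times> complex. 0 \<le> fst (snd x) \<and> Im (T x) = 0 \<and> 0 \<le> Re (T x)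
    \<and> (Im (k / cnj c) = 0 \<longrightarrow> Im (snd (snd x) / cnj c) = 0)}"
  have "linear L"
    by (rule linearI) (auto simp: L_def algebra_simps scaleR_conv_of_real)
  moreover have "inj L"
    using c by (auto intro!: injI simp: L_def)
  moreover have "closed C"
    unfolding C_def T_def case_prod_beta
    by (intro closed_Collect_conj closed_Collect_eq closed_Collect_le closed_Collect_imp continuous_intros)
      (use c k in auto)
  ultimately have "closed (L ` C)"
    by (intro closed_injective_linear_image)
  then obtain x' where x': "x' \<in> L ` C" "\<nu> \<in> orb (br x')"
  proof (rule closure_orb_tri[OF _ _ \<nu>])
    fix \<alpha> \<gamma> :: real and \<beta> :: complex
    assume pos: "\<alpha> > 0" "\<gamma> > 0"
    define \<pi> where "\<pi> = (of_real (\<alpha> * \<alpha>) * k + \<beta> * cnj \<beta> * cnj c) / (2 * of_real \<gamma>)"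
    have re: "complex_of_real (Re c) = (c + cnj c) / 2" by (simp add: complex_eq_iff)
    have "tri (of_real \<alpha>) \<beta> (of_real \<gamma>) (Wpar c k) = L (\<beta>, \<gamma>, \<pi>)"
      using pos by (simp add: L_def Wpar_def Let_def \<pi>_def re) (simp add: field_simps)
    moreover have "(\<beta>, \<gamma>, \<pi>) \<in> C"
    proof -
      have "T (\<beta>, \<gamma>, \<pi>) = of_real (\<alpha> * \<alpha>)"
        using k pos by (simp add: T_def \<pi>_def)
      moreover have "Im (\<pi> / cnj c) = 0" if "Im (k / cnj c) = 0"
      proof -
        define x where "x = k / cnj c"
        have "\<pi> / cnj c = (of_real (\<alpha> * \<alpha>) * x + of_real ((norm \<beta>)\<^sup>2)) / of_real (2 * \<gamma>)"
          using c pos unfolding complex_norm_square by (simp add: \<pi>_def x_def field_simps)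
        moreover have "Im x = 0" using that by (simp add: x_def)
        ultimately show ?thesis
          by (simp only: Im_divide_of_real) simp
      qed
      ultimately show ?thesis
        using pos by (simp add: C_def)
    qed
    ultimately show "tri (of_real \<alpha>) \<beta> (of_real \<gamma>) (Wpar c k) \<in> L ` C" by simp
  qed blast
  then obtain \<beta> \<gamma> \<pi> where C: "(\<beta>, \<gamma>, \<pi>) \<in> C" "\<nu> \<in> orb (br (L (\<beta>, \<gamma>, \<pi>)))" by auto
  define t where "t = Re (T (\<beta>, \<gamma>, \<pi>))"
  have t: "t \<ge> 0" "\<gamma> \<ge> 0" and T: "2 * of_real \<gamma> * \<pi> = of_real t * k + \<beta> * cnj \<beta> * cnj c"
  proof -
    have "T (\<beta>, \<gamma>, \<pi>) = of_real t"
      using C(1) by (simp add: C_def t_def complex_eq_iff)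
    then show "2 * of_real \<gamma> * \<pi> = of_real t * k + \<beta> * cnj \<beta> * cnj c"
      using k by (simp add: T_def field_simps)
  qed (use C(1) in \<open>auto simp: C_def t_def\<close>)
  have re: "complex_of_real (Re c) = (c + cnj c) / 2" by (simp add: complex_eq_iff)
  show ?thesis
  proof (cases "\<gamma> = 0")
    case g: False
    then have \<pi>: "\<pi> = (of_real t * k + \<beta> * cnj \<beta> * cnj c) / (2 * of_real \<gamma>)"
      using T by (simp add: field_simps)
    show ?thesis
    proof (cases "t = 0")
      case True
      \<comment> \<open>For \<open>k = 0\<close> the first diagonal entry cancels from all
        constants, so 1 serves as well as any other.\<close>
      have "L (\<beta>, \<gamma>, \<pi>) = tri 1 \<beta> (of_real \<gamma>) (Wpar c 0)"
        using g T True by (simp add: L_def Wpar_def Let_def re) (simp add: field_simps)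
      then have "br (L (\<beta>, \<gamma>, \<pi>)) \<in> orb (br (Wpar c 0))"
        using g by (metis orb_tri of_real_eq_0_iff zero_neq_one)
      then show ?thesis using C(2) orb_trans by blast
    next
      case False
      have "of_real (sqrt t) * of_real (sqrt t) = complex_of_real t"
        using t by (simp flip: of_real_mult)
      then have "L (\<beta>, \<gamma>, \<pi>) = tri (of_real (sqrt t)) \<beta> (of_real \<gamma>) (Wpar c k)"
        using g False \<pi> by (simp add: L_def Wpar_def Let_def re) (simp add: field_simps)
      then have "br (L (\<beta>, \<gamma>, \<pi>)) \<in> orb (br (Wpar c k))"
        using g False by (metis orb_tri of_real_eq_0_iff real_sqrt_eq_zero_cancel_iff)
      then show ?thesis using C(2) orb_trans by blast
    qed
  next
    case g: True
    show ?thesis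
    proof (cases "\<beta> = 0")
      case True
      then have "L (\<beta>, \<gamma>, \<pi>) = Ipar 0 0 0 0 \<pi>"
        using g by (simp add: L_def Ipar_def)
      then show ?thesis using C(2) Ipar_0_orb_cases by metis
    next
      case b: False
      have tk: "of_real t * k = - (of_real ((norm \<beta>)\<^sup>2) * cnj c)"
        using T g unfolding complex_norm_square by (simp add: add_eq_0_iff)
      then have "t \<noteq> 0" using b c by auto
      then have kc: "k = of_real (- (norm \<beta>)\<^sup>2 / t) * cnj c" "- (norm \<beta>)\<^sup>2 / t < 0"
        using tk t b by (auto simp: field_simps)
      then have "k / cnj c = of_real (- (norm \<beta>)\<^sup>2 / t)" using c by simp
      then have "Im (k / cnj c) = 0" by simp
      then have "Im (\<pi> / cnj c) = 0" using C(1) by (simp add: C_def)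
      then have \<pi>: "\<pi> = cnj c * of_real (Re (\<pi> / cnj c))"
        using c by (simp add: complex_is_Real_iff[symmetric])
      have "L (\<beta>, \<gamma>, \<pi>) = Ipar (\<beta> * (c / 2)) (cnj \<beta> * of_real (Re c)) (\<beta> * (cnj c / 2)) (cnj \<beta> * (c / 2)) \<pi>"
        using g by (simp add: L_def Ipar_def)
      also have "br \<dots> \<in> orb (br (Vpar c 0))"
        unfolding Vpar_def
        using b \<pi>
        by (intro orb_Ipar[of \<beta> 1 _ _ _ _ _ _ _ _ _ _ "of_real (Re (\<pi> / cnj c)) / cnj \<beta>"])
          (simp_all add: Vpar_diff)
      finally show ?thesis using C(2) kc orb_trans by blast
    qed
  qed
qed

text \<open>Both diagonal entries and the shear remain visible in the constants. If
  \<open>\<gamma> = 0\<close>, the relation for \<open>\<pi>\<close> forces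
  \<open>\<beta> = 0\<close> or \<open>\<beta> = \<alpha>\<close>; these solutions give
  \<open>Mu6 0 0\<close> and \<open>Mu10 1\<close> when \<open>\<alpha> \<noteq> 0\<close>.\<close>

lemma closure_Mu2:
  assumes \<nu>: "\<nu> \<in> closure (orb (bracket Mu2))"
  shows "\<nu> \<in> orb (bracket Mu2) \<or> \<nu> \<in> orb (bracket (Mu6 0 0)) \<or> \<nu> \<in> orb (bracket (Mu10 1))
    \<or> \<nu> \<in> orb (bracket Mu1) \<or> \<nu> = 0"
proof -
  define L :: "real \<times> real \<times> complex \<times> complex \<Rightarrow> par" where "L = (\<lambda>(\<alpha>, \<gamma>, \<beta>, \<pi>).
    (0, 0, of_real \<alpha> / 2, \<pi>, 0, cnj \<beta> / 2, 0, \<beta> / 2, 0, of_real \<gamma> / 2))"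
  define C where "C = {x :: real \<times> real \<times> complex \<times> complex. 0 \<le> fst x \<and> 0 \<le> fst (snd x)
    \<and> 2 * of_real (fst (snd x)) * snd (snd (snd x))
      = fst (snd (snd x)) * (cnj (fst (snd (snd x))) - of_real (fst x))}"
  have "linear L"
    by (rule linearI) (auto simp: L_def algebra_simps add_divide_distrib scaleR_conv_of_real)
  moreover have "inj L"
    by (auto intro!: injI simp: L_def)
  moreover have "closed C"
    unfolding C_def
    by (intro closed_Collect_conj closed_Collect_eq closed_Collect_le continuous_intros)
  ultimately have "closed (L ` C)"
    by (intro closed_injective_linear_image)
  then obtain x' where x': "x' \<in> L ` C" "\<nu> \<in> orb (br x')"
  proof (rule closure_orb_tri[OF _ _ \<nu>[unfolded bracket_br]])
    fix \<alpha> \<gamma> :: real and \<beta> :: complex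
    assume pos: "\<alpha> > 0" "\<gamma> > 0"
    define \<pi> where "\<pi> = \<beta> * (cnj \<beta> - of_real \<alpha>) / (2 * of_real \<gamma>)"
    have "tri (of_real \<alpha>) \<beta> (of_real \<gamma>) (prm Mu2) = L (\<alpha>, \<gamma>, \<beta>, \<pi>)"
      using pos by (simp add: L_def Let_def \<pi>_def) (simp add: field_simps)
    moreover have "(\<alpha>, \<gamma>, \<beta>, \<pi>) \<in> C"
      using pos by (simp add: C_def \<pi>_def)
    ultimately show "tri (of_real \<alpha>) \<beta> (of_real \<gamma>) (prm Mu2) \<in> L ` C" by simp
  qed blast
  then obtain \<alpha> \<gamma> \<beta> \<pi> where C: "(\<alpha>, \<gamma>, \<beta>, \<pi>) \<in> C" "\<nu> \<in> orb (br (L (\<alpha>, \<gamma>, \<beta>, \<pi>)))" by auto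
  then have \<pi>: "2 * of_real \<gamma> * \<pi> = \<beta> * (cnj \<beta> - of_real \<alpha>)" by (simp add: C_def)
  have *: ?thesis if "br (L (\<alpha>, \<gamma>, \<beta>, \<pi>)) \<in> orb (br (prm y))" "y \<in> {Mu2, Mu6 0 0, Mu10 1}" for y
    using orb_trans[OF that(1) C(2)] that(2) unfolding bracket_br by blast
  show ?thesis
  proof (cases "\<gamma> = 0")
    case g: False
    have \<pi>': "\<pi> = \<beta> * (cnj \<beta> - of_real \<alpha>) / (2 * of_real \<gamma>)"
      using \<pi> g by (simp add: field_simps)
    show ?thesis
    proof (cases "\<alpha> = 0")
      case True
      have "br (L (\<alpha>, \<gamma>, \<beta>, \<pi>)) \<in> orb (br (prm (Mu6 0 0)))"
        using g True \<pi>' by (intro orb_brI[of \<beta> 0 "of_real \<gamma>" 1]) (simp_all add: L_def Ipar_def Complex_eq)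
      then show ?thesis by (rule *) simp
    next
      case False
      have "L (\<alpha>, \<gamma>, \<beta>, \<pi>) = tri (of_real \<alpha>) \<beta> (of_real \<gamma>) (prm Mu2)"
        using g False by (simp add: L_def Let_def \<pi>') (simp add: field_simps)
      then have "br (L (\<alpha>, \<gamma>, \<beta>, \<pi>)) \<in> orb (br (prm Mu2))"
        using g False by (metis orb_tri of_real_eq_0_iff)
      then show ?thesis by (rule *) simp
    qed
  next
    case g: True
    show ?thesis
    proof (cases "\<alpha> = 0")
      case True
      then have "L (\<alpha>, \<gamma>, \<beta>, \<pi>) = Ipar 0 0 0 0 \<pi>" using g \<pi> by (simp add: L_def Ipar_def)
      then show ?thesis using C(2) Ipar_0_orb_cases by metis
    next
      case a: False
      have "\<beta> = 0 \<or> cnj \<beta> = of_real \<alpha>"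
        using g \<pi> by auto
      then consider "\<beta> = 0" | "\<beta> = of_real \<alpha>"
        by (metis complex_cnj_cnj complex_cnj_complex_of_real)
      then show ?thesis
      proof cases
        case 1
        then have "L (\<alpha>, \<gamma>, \<beta>, \<pi>) = Ipar 0 0 0 (of_real \<alpha> / 2) \<pi>" using g by (simp add: L_def Ipar_def)
        also have "br \<dots> \<in> orb (br (prm (Mu6 0 0)))"
          unfolding prm.simps using a
          by (intro orb_Ipar[of "of_real \<alpha>" 1 _ _ _ _ _ _ _ _ _ _ "- 2 * \<pi> / of_real \<alpha>"]) (simp_all add: Complex_eq)
        finally show ?thesis by (rule *) simp
      next
        case 2
        then have "L (\<alpha>, \<gamma>, \<beta>, \<pi>) = Ipar 0 (of_real \<alpha> / 2) (of_real \<alpha> / 2) (of_real \<alpha> / 2) \<pi>"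
          using g by (simp add: L_def Ipar_def)
        \<comment> \<open>Multiplying the second basis vector by \<open>\<i>\<close> changes the
          sign of \<open>R\<close>, which scales with
          \<open>cnj \<gamma> / \<gamma>\<close>.\<close>
        also have "br \<dots> \<in> orb (br (prm (Mu10 1)))"
          unfolding prm.simps using a
          by (intro orb_Ipar[of "of_real \<alpha>" 1 _ _ _ _ _ _ _ _ _ _ "cnj (2 * \<pi> / of_real \<alpha>)"]) simp_all
        finally show ?thesis by (rule *) simp
      qed
    qed
  qed
qed

text \<open>The basis of idempotents of the complexified algebra diagonalises \<open>\<mu>\<^sub>4\<close>.\<close>

definition Dpar :: par where "Dpar = (0, 0, 0, 0, 0, 1 / 2, 1 / 2, 0, 0, 0)"

lemma Mu4_orb: "bracket Mu4 \<in> orb (br Dpar)"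
  unfolding bracket_br by (rule orb_brI[of 1 "- \<i>" \<i> 1]) (simp_all add: Dpar_def)

lemma closure_Mu4:
  assumes \<nu>: "\<nu> \<in> closure (orb (bracket Mu4))"
  shows "\<nu> \<in> orb (bracket Mu4) \<or> \<nu> \<in> orb (bracket (Mu3 0 1)) \<or> \<nu> \<in> orb (bracket (Mu10 1))
    \<or> \<nu> \<in> orb (bracket Mu1) \<or> \<nu> = 0"
proof -
  have \<nu>': "\<nu> \<in> closure (orb (br Dpar))"
    using \<nu> orb_eq[OF Mu4_orb] by simp
  define L :: "real \<times> real \<times> complex \<times> complex \<Rightarrow> par" where "L = (\<lambda>(\<alpha>, \<gamma>, \<beta>, \<pi>).
    (0, 0, cnj \<beta> / 2, \<pi>, 0, of_real \<alpha> / 2, of_real \<gamma> / 2, - \<beta> / 2, 0, 0))"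
  define C where "C = {x :: real \<times> real \<times> complex \<times> complex. 0 \<le> fst x \<and> 0 \<le> fst (snd x)
    \<and> 2 * of_real (fst (snd x)) * snd (snd (snd x))
      = fst (snd (snd x)) * (of_real (fst x) - cnj (fst (snd (snd x))))}"
  have "linear L"
    by (rule linearI) (auto simp: L_def algebra_simps add_divide_distrib diff_divide_distrib scaleR_conv_of_real)
  moreover have "inj L"
    by (auto intro!: injI simp: L_def)
  moreover have "closed C"
    unfolding C_def
    by (intro closed_Collect_conj closed_Collect_eq closed_Collect_le continuous_intros)
  ultimately have "closed (L ` C)"
    by (intro closed_injective_linear_image)
  then obtain x' where x': "x' \<in> L ` C" "\<nu> \<in> orb (br x')"
  proof (rule closure_orb_tri[OF _ _ \<nu>'])
    fix \<alpha> \<gamma> :: real and \<beta> :: complex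
    assume pos: "\<alpha> > 0" "\<gamma> > 0"
    define \<pi> where "\<pi> = \<beta> * (of_real \<alpha> - cnj \<beta>) / (2 * of_real \<gamma>)"
    have "tri (of_real \<alpha>) \<beta> (of_real \<gamma>) Dpar = L (\<alpha>, \<gamma>, \<beta>, \<pi>)"
      using pos by (simp add: L_def Let_def \<pi>_def Dpar_def) (simp add: field_simps)
    moreover have "(\<alpha>, \<gamma>, \<beta>, \<pi>) \<in> C"
      using pos by (simp add: C_def \<pi>_def)
    ultimately show "tri (of_real \<alpha>) \<beta> (of_real \<gamma>) Dpar \<in> L ` C" by simp
  qed blast
  then obtain \<alpha> \<gamma> \<beta> \<pi> where C: "(\<alpha>, \<gamma>, \<beta>, \<pi>) \<in> C" "\<nu> \<in> orb (br (L (\<alpha>, \<gamma>, \<beta>, \<pi>)))" by auto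
  then have \<pi>: "2 * of_real \<gamma> * \<pi> = \<beta> * (of_real \<alpha> - cnj \<beta>)" by (simp add: C_def)
  have *: ?thesis if "br (L (\<alpha>, \<gamma>, \<beta>, \<pi>)) \<in> orb (br (prm y))" "y \<in> {Mu4, Mu3 0 1, Mu10 1}" for y
    using orb_trans[OF that(1) C(2)] that(2) unfolding bracket_br by blast
  show ?thesis
  proof (cases "\<gamma> = 0")
    case g: False
    have \<pi>': "\<pi> = \<beta> * (of_real \<alpha> - cnj \<beta>) / (2 * of_real \<gamma>)"
      using \<pi> g by (simp add: field_simps)
    show ?thesis
    proof (cases "\<alpha> = 0")
      case True
      have "br (L (\<alpha>, \<gamma>, \<beta>, \<pi>)) \<in> orb (br (prm (Mu3 0 1)))"
        using g True \<pi>' by (intro orb_brI[of "\<beta> / 2" 0 "of_real \<gamma> / 2" 1]) (simp_all add: L_def Ipar_def Complex_eq)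
      then show ?thesis by (rule *) simp
    next
      case False
      have "L (\<alpha>, \<gamma>, \<beta>, \<pi>) = tri (of_real \<alpha>) \<beta> (of_real \<gamma>) Dpar"
        using g False by (simp add: L_def Let_def \<pi>' Dpar_def) (simp add: field_simps)
      then have "br (L (\<alpha>, \<gamma>, \<beta>, \<pi>)) \<in> orb (br Dpar)"
        using g False by (metis orb_tri of_real_eq_0_iff)
      then have "br (L (\<alpha>, \<gamma>, \<beta>, \<pi>)) \<in> orb (br (prm Mu4))"
        using orb_eq[OF Mu4_orb] by (simp only: bracket_br)
      then show ?thesis by (rule *) simp
    qed
  next
    case g: True
    show ?thesis
    proof (cases "\<alpha> = 0")
      case True
      then have "L (\<alpha>, \<gamma>, \<beta>, \<pi>) = Ipar 0 0 0 0 \<pi>" using g \<pi> by (simp add: L_def Ipar_def)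
      then show ?thesis using C(2) Ipar_0_orb_cases by metis
    next
      case a: False
      have "\<beta> = 0 \<or> cnj \<beta> = of_real \<alpha>"
        using g \<pi> by auto
      then consider "\<beta> = 0" | "\<beta> = of_real \<alpha>"
        by (metis complex_cnj_cnj complex_cnj_complex_of_real)
      then show ?thesis
      proof cases
        case 1
        then have "L (\<alpha>, \<gamma>, \<beta>, \<pi>) = Ipar 0 (of_real \<alpha> / 2) 0 0 \<pi>" using g by (simp add: L_def Ipar_def)
        also have "br \<dots> \<in> orb (br (prm (Mu3 0 1)))"
          unfolding prm.simps using a
          by (intro orb_Ipar[of "of_real \<alpha> / 2" 1 _ _ _ _ _ _ _ _ _ _ "2 * \<pi> / of_real \<alpha>"]) (simp_all add: Complex_eq)
        finally show ?thesis by (rule *) simp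
      next
        case 2
        then have "L (\<alpha>, \<gamma>, \<beta>, \<pi>) = Ipar 0 (of_real \<alpha> / 2) (- of_real \<alpha> / 2) (of_real \<alpha> / 2) \<pi>"
          using g by (simp add: L_def Ipar_def)
        also have "br \<dots> \<in> orb (br (prm (Mu10 1)))"
          unfolding prm.simps using a
          by (intro orb_Ipar[of "of_real \<alpha>" \<i> _ _ _ _ _ _ _ _ _ _ "cnj (2 * \<i> * \<pi> / of_real \<alpha>)"]) simp_all
        finally show ?thesis by (rule *) simp
      qed
    qed
  qed
qed

section \<open>Matching the normal forms with the names of the list\<close>

lemma Xpar_orb: "br (Xpar c) \<in> orb (br (Wpar c 1))"
  by (rule orb_brI[of 0 0 1 1]) (simp_all add: Wpar_def Xpar_def)

text \<open>For \<open>k = 0\<close> the complex line through \<open>e 1\<close> is an abelian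
  ideal, so exchanging the complex coordinates leads into \<open>Ipar\<close>.\<close>

lemma Wpar_0_orb:
  assumes "\<alpha> \<noteq> 0" "c = \<alpha> * d" "complex_of_real (Re c) = \<alpha> * P" "cnj \<alpha> = \<alpha>"
  shows "br (Wpar c 0) \<in> orb (br (Ipar (d / 2) (d / 2) 0 P 0))"
  using assms by (intro orb_brI[of 0 0 \<alpha> 1]) (simp_all add: Wpar_def Ipar_def)

text \<open>Dividing \<open>c\<close> by \<open>2 * Re c\<close> normalises its real part to 1/2.
  The ratio left in the imaginary part is the origin of the parameters 1/(2\<delta>) and
  -1/(2\<delta>) in the arrows from \<mu>_13.\<close>

lemma Wpar_0_Mu6:
  assumes "Re c \<noteq> 0" "b = Im c / (2 * Re c)"
  shows "br (Wpar c 0) \<in> orb (bracket (Mu6 (1/2) b))"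
  unfolding bracket_br prm.simps using assms
  by (intro Wpar_0_orb[of "of_real (2 * Re c)"]) (auto simp: complex_eq_iff)

lemma Wpar_0_Mu7:
  assumes "c = \<i> \<or> c = - \<i>"
  shows "br (Wpar c 0) \<in> orb (bracket (Mu7 0))"
  unfolding bracket_br prm.simps
  by (rule Wpar_0_orb[of "of_real (Im c)"]) (use assms in \<open>auto simp: complex_eq_iff\<close>)

lemma Vpar_Mu10_2: "br (Vpar (- 1 / 2) 0) \<in> orb (bracket (Mu10 2))"
  unfolding bracket_br prm.simps Vpar_def
  by (rule orb_Ipar[of "- 1 / 2" 1 _ _ _ _ _ _ _ _ _ _ 0]) (auto simp: complex_eq_iff)

lemma Vpar_Mu10_0: "br (Vpar (- \<i>) 0) \<in> orb (bracket (Mu10 0))"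
  unfolding bracket_br prm.simps Vpar_def
  by (rule orb_Ipar[of \<i> 1 _ _ _ _ _ _ _ _ _ _ 0]) (auto simp: complex_eq_iff)

lemma Mu10_2_Vpar: "bracket (Mu10 2) = br (Vpar 1 0)"
  by (simp add: bracket_br Vpar_def)

lemma Mu14_Vpar: "bracket Mu14 = br (Vpar 1 (- \<i> / 2))"
  by (simp add: bracket_br Vpar_def)

lemma Mu12_orb: "bracket Mu12 \<in> orb (br (Vpar (- \<i>) (1 / 2)))"
  unfolding bracket_br prm.simps Vpar_def
  by (rule orb_Ipar[of "- \<i>" 1 _ _ _ _ _ _ _ _ _ _ 0]) (auto simp: complex_eq_iff)

section \<open>From closures to the arrow relation\<close>

definition below :: "mu_name \<Rightarrow> bilin \<Rightarrow> bool" where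
  "below x \<nu> \<longleftrightarrow> (\<exists>y. arrow\<^sup>*\<^sup>* x y \<and> \<nu> \<in> orb (bracket y))"

lemma below_self: "\<nu> \<in> orb (bracket x) \<Longrightarrow> below x \<nu>"
  by (auto simp: below_def)

lemma below_step: "arrow x y \<Longrightarrow> below y \<nu> \<Longrightarrow> below x \<nu>"
  unfolding below_def by (meson converse_rtranclp_into_rtranclp)

lemma below_Mu0: "below Mu0 0"
  by (rule below_self) (simp add: orb_0)

lemma below_arrow_Mu0:
  assumes "\<nu> \<in> orb (bracket x) \<or> \<nu> = 0" "arrow x Mu0"
  shows "below x \<nu>"
  using assms(1) below_self below_step[OF assms(2) below_Mu0] by metis

lemma below_arrow_Mu1:
  assumes "\<nu> \<in> orb (bracket x) \<or> \<nu> \<in> orb (bracket Mu1) \<or> \<nu> = 0" "arrow x Mu1"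
  shows "below x \<nu>"
  using assms(1) below_self below_step[OF assms(2)] below_arrow_Mu0[OF _ arrow.intros(28)] by metis

lemma below_arrow:
  assumes "\<nu> \<in> orb (bracket x) \<or> \<nu> \<in> orb (bracket y) \<or> \<nu> \<in> orb (bracket Mu1) \<or> \<nu> = 0"
    and "arrow x y" "arrow y Mu1"
  shows "below x \<nu>"
  using assms(1) below_self below_step[OF assms(2)] below_arrow_Mu1[OF _ assms(3)] by metis

text \<open>Common treatment of \<mu>_8, \<mu>_11 and \<mu>_13: \<open>y\<close> is the limit at
  \<open>k = 0\<close>, while \<open>z\<close> supplies the second arrow when \<open>k\<close> is a
  negative multiple of \<open>cnj c\<close>.\<close>

lemma below_Wpar:
  assumes x: "bracket x \<in> orb (br (Wpar c k))" "c \<noteq> 0" "k \<noteq> 0"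
    and y: "br (Wpar c 0) \<in> orb (bracket y)" "arrow x y" "arrow y Mu1"
    and z: "\<And>r. r < 0 \<Longrightarrow> k = of_real r * cnj c \<Longrightarrow> \<exists>z. br (Vpar c 0) \<in> orb (bracket z) \<and> arrow x z"
    and \<nu>: "\<nu> \<in> closure (orb (bracket x))"
  shows "below x \<nu>"
proof -
  have "\<nu> \<in> closure (orb (br (Wpar c k)))"
    using \<nu> orb_eq[OF x(1)] by simp
  from closure_Wpar[OF x(2,3) this] consider
      "\<nu> \<in> orb (bracket x)" | "\<nu> \<in> orb (bracket y)" | "\<nu> \<in> orb (bracket Mu1) \<or> \<nu> = 0"
    | r where "r < 0" "k = of_real r * cnj c" "\<nu> \<in> orb (br (Vpar c 0))"
    using orb_eq[OF x(1)] orb_eq[OF y(1)] by auto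
  then show ?thesis
  proof cases
    case 4
    then obtain z where "br (Vpar c 0) \<in> orb (bracket z)" "arrow x z" using z by blast
    then show ?thesis using orb_trans[OF _ 4(3)] below_self below_step by metis
  qed (use below_arrow[OF _ y(2,3)] in metis)+
qed

lemma below_closure:
  assumes "listed x" and \<nu>: "\<nu> \<in> closure (orb (bracket x))"
  shows "below x \<nu>"
proof (cases x)
  case Mu0
  then show ?thesis using \<nu> below_Mu0 by (simp add: orb_0)
next
  case Mu1
  have "\<exists>\<pi>. \<nu> \<in> orb (br (Ipar 0 0 0 0 \<pi>))"
    using \<nu> unfolding Mu1 bracket_br prm.simps
    by (rule closure_Ipar[OF closed_UNIV, rotated]) auto
  then show ?thesis
    unfolding Mu1 using below_arrow_Mu0[OF _ arrow.intros(28)] Ipar_0_orb_cases by metis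
next
  case Mu2
  have "below Mu2 \<nu>" if "\<nu> \<in> orb (bracket (Mu6 0 0))"
    by (rule below_step[OF arrow.intros(8) below_self[OF that]])
  then show ?thesis
    using closure_Mu2[of \<nu>] \<nu> below_arrow[OF _ arrow.intros(7,27)] unfolding Mu2 by metis
next
  case (Mu3 a b)
  show ?thesis
  proof (cases "(a, b) = (0, - 1)")
    case True
    then have x: "prm x = Ipar 1 0 0 0 0" by (simp add: Mu3 Complex_eq)
    have "\<nu> \<in> orb (br (prm x)) \<or> \<nu> = 0"
      using closure_Ipar_rigid \<nu> unfolding x bracket_br by blast
    then have "\<nu> \<in> orb (bracket x) \<or> \<nu> = 0" by (simp add: bracket_br)
    moreover have "arrow x Mu0" using True by (simp add: Mu3 arrow.intros)
    ultimately show ?thesis by (rule below_arrow_Mu0)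
  next
    case False
    then have "norm (Complex (1 + b) (- a) / 2 - 0) \<noteq> norm (0 :: complex)"
      by (auto simp: complex_eq_iff)
    from closure_Ipar_free[OF this] \<nu>
    have "\<nu> \<in> orb (bracket x) \<or> \<nu> \<in> orb (bracket Mu1) \<or> \<nu> = 0"
      unfolding Mu3 bracket_br[of "Mu3 a b"] prm.simps by blast
    \<comment> \<open>Here \<open>listed\<close> excludes \<open>b = 0\<close> with
      \<open>a \<noteq> 0\<close>.\<close>
    moreover have "arrow x Mu1"
      using False assms(1) by (auto simp: Mu3 intro: arrow.intros)
    ultimately show ?thesis by (rule below_arrow_Mu1)
  qed
next
  case Mu4
  have "below Mu4 \<nu>" if "\<nu> \<in> orb (bracket (Mu3 0 1))"
    by (rule below_step[OF arrow.intros(10) below_self[OF that]])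
  then show ?thesis
    using closure_Mu4[of \<nu>] \<nu> below_arrow[OF _ arrow.intros(9,27)] unfolding Mu4 by metis
next
  case Mu5
  have "prm (Mu3 0 (- 1)) = Ipar 1 0 0 0 0" by (simp add: Complex_eq)
  then have "\<nu> \<in> orb (bracket Mu5) \<or> \<nu> \<in> orb (bracket (Mu3 0 (- 1))) \<or> \<nu> \<in> orb (bracket Mu1) \<or> \<nu> = 0"
    using closure_Ipar_shear[of "1/2" \<nu> 1 0] \<nu>
    by (simp add: Mu5 bracket_br[of Mu5] bracket_br[of "Mu3 0 (- 1)"] del: prm.simps(4))
  then show ?thesis
    unfolding Mu5 using below_arrow_Mu1[OF _ arrow.intros(12)] below_step[OF arrow.intros(11) below_self] by metis
next
  case (Mu6 a b)
  show ?thesis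
  proof (cases "(a, b) = (1, 0)")
    case True
    then have x: "prm x = Ipar (1 / 2) (1 / 2) 0 (1 / 2) 0" by (simp add: Mu6 Complex_eq)
    have "\<nu> \<in> orb (br (prm x)) \<or> \<nu> = 0"
      using closure_Ipar_rigid \<nu> unfolding x bracket_br by blast
    then have "\<nu> \<in> orb (bracket x) \<or> \<nu> = 0" by (simp add: bracket_br)
    moreover have "arrow x Mu0" using True by (simp add: Mu6 arrow.intros)
    ultimately show ?thesis by (rule below_arrow_Mu0)
  next
    case False
    then have "norm (Complex a b / 2 - 1 / 2) \<noteq> norm (0 :: complex)"
      by (auto simp: complex_eq_iff)
    from closure_Ipar_free[OF this] \<nu>
    have "\<nu> \<in> orb (bracket x) \<or> \<nu> \<in> orb (bracket Mu1) \<or> \<nu> = 0"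
      unfolding Mu6 bracket_br[of "Mu6 a b"] prm.simps by blast
    moreover have "arrow x Mu1"
      using False by (auto simp: Mu6 intro: arrow.intros)
    ultimately show ?thesis by (rule below_arrow_Mu1)
  qed
next
  case (Mu7 a)
  have "norm (Complex a 1 / 2 - 0) \<noteq> norm (0 :: complex)"
    by (auto simp: complex_eq_iff)
  from closure_Ipar_free[OF this] \<nu>
  have "\<nu> \<in> orb (bracket x) \<or> \<nu> \<in> orb (bracket Mu1) \<or> \<nu> = 0"
    unfolding Mu7 bracket_br[of "Mu7 a"] prm.simps by blast
  moreover have "arrow x Mu1" by (auto simp: Mu7 intro: arrow.intros)
  ultimately show ?thesis by (rule below_arrow_Mu1)
next
  case (Mu8p a)
  show ?thesis
    unfolding Mu8p
  proof (rule below_Wpar[where c = "- \<i>" and k = "Complex a 1" and y = "Mu7 0"])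
    show "bracket (Mu8p a) \<in> orb (br (Wpar (- \<i>) (Complex a 1)))"
      by (simp add: bracket_br orb_refl)
  qed (use \<nu> Mu8p in \<open>auto intro: arrow.intros Wpar_0_Mu7 simp: complex_eq_iff\<close>)
next
  case (Mu8m a)
  show ?thesis
    unfolding Mu8m
  proof (rule below_Wpar[where c = "- \<i>" and k = "Complex a (- 1)" and y = "Mu7 0"])
    show "bracket (Mu8m a) \<in> orb (br (Wpar (- \<i>) (Complex a (- 1))))"
      by (simp add: bracket_br orb_refl)
    fix r :: real
    assume "Complex a (- 1) = of_real r * cnj (- \<i>)"
    then have "a = 0" by (simp add: complex_eq_iff)
    then show "\<exists>z. br (Vpar (- \<i>) 0) \<in> orb (bracket z) \<and> arrow (Mu8m a) z"
      using Vpar_Mu10_0 arrow.intros(5) by blast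
  qed (use \<nu> Mu8m in \<open>auto intro: arrow.intros Wpar_0_Mu7 simp: complex_eq_iff\<close>)
next
  case Mu9
  have "prm (Mu6 1 0) = Ipar (1/2) (1/2) 0 (1/2) 0" by (simp add: Complex_eq)
  then have "\<nu> \<in> orb (bracket Mu9) \<or> \<nu> \<in> orb (bracket (Mu6 1 0)) \<or> \<nu> \<in> orb (bracket Mu1) \<or> \<nu> = 0"
    using closure_Ipar_shear[of "1/2" \<nu> "1/2" "1/2"] \<nu>
    by (simp add: Mu9 bracket_br[of Mu9] bracket_br[of "Mu6 1 0"] del: prm.simps(7))
  then show ?thesis
    unfolding Mu9 using below_arrow_Mu1[OF _ arrow.intros(22)] below_step[OF arrow.intros(21) below_self] by metis
next
  case (Mu10 a)
  \<comment> \<open>The norms of \<open>B - P\<close> and \<open>R\<close> are |a - 1|/2 and 1/2;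
    they agree exactly for \<open>a = 0\<close> and \<open>a = 2\<close>, the two members of the
    family \<open>Vpar\<close>.\<close>
  consider "a = 0" | "a = 2" | "a \<noteq> 0" "a \<noteq> 2" by blast
  then have "\<nu> \<in> orb (bracket x) \<or> \<nu> \<in> orb (bracket Mu1) \<or> \<nu> = 0"
  proof cases
    case 1
    then show ?thesis
      using closure_Vpar_0[of "- \<i>" \<nu>] \<nu> orb_eq[OF Vpar_Mu10_0] by (simp add: Mu10)
  next
    case 2
    then show ?thesis
      using closure_Vpar_0[of 1 \<nu>] \<nu> Mu10_2_Vpar by (simp add: Mu10)
  next
    case 3
    have "complex_of_real a / 2 - 1 / 2 = of_real ((a - 1) / 2)" by (simp add: diff_divide_distrib)
    then have "norm (complex_of_real a / 2 - 1 / 2) \<noteq> norm (1 / 2 :: complex)"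
      using 3 by (simp only: norm_of_real) (auto simp: abs_if)
    from closure_Ipar_free[OF this] \<nu> show ?thesis
      unfolding Mu10 bracket_br[of "Mu10 a"] prm.simps by blast
  qed
  moreover have "arrow x Mu1" by (auto simp: Mu10 intro: arrow.intros)
  ultimately show ?thesis by (rule below_arrow_Mu1)
next
  case Mu11p
  show ?thesis
    unfolding Mu11p
  proof (rule below_Wpar[where c = "1 / 2" and k = 1 and y = "Mu6 (1/2) 0"])
    show "bracket Mu11p \<in> orb (br (Wpar (1 / 2) 1))"
      by (simp add: bracket_br Xpar_orb)
    show "br (Wpar (1 / 2) 0) \<in> orb (bracket (Mu6 (1/2) 0))"
      by (rule Wpar_0_Mu6) auto
  qed (use \<nu> Mu11p in \<open>auto intro: arrow.intros simp: complex_eq_iff\<close>)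
next
  case Mu11m
  show ?thesis
    unfolding Mu11m
  proof (rule below_Wpar[where c = "- 1 / 2" and k = 1 and y = "Mu6 (1/2) 0"])
    show "bracket Mu11m \<in> orb (br (Wpar (- 1 / 2) 1))"
      using Xpar_orb[of "- 1 / 2"] by (simp add: bracket_br)
    show "br (Wpar (- 1 / 2) 0) \<in> orb (bracket (Mu6 (1/2) 0))"
      by (rule Wpar_0_Mu6) auto
    show "\<exists>z. br (Vpar (- 1 / 2) 0) \<in> orb (bracket z) \<and> arrow Mu11m z"
      using Vpar_Mu10_2 arrow.intros(19) by blast
  qed (use \<nu> Mu11m in \<open>auto intro: arrow.intros simp: complex_eq_iff\<close>)
next
  case Mu12
  have "\<nu> \<in> orb (bracket Mu12) \<or> \<nu> \<in> orb (bracket (Mu10 0)) \<or> \<nu> \<in> orb (bracket Mu1) \<or> \<nu> = 0"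
    using closure_Vpar[of "- \<i>" "1 / 2" \<nu>] \<nu> orb_eq[OF Mu12_orb] orb_eq[OF Vpar_Mu10_0]
    by (simp add: Mu12)
  then show ?thesis
    unfolding Mu12 by (rule below_arrow[OF _ arrow.intros(6,27)])
next
  case (Mu13p a)
  let ?y = "if a = 0 then Mu7 0 else Mu6 (1/2) (1 / (2 * a))"
  show ?thesis
    unfolding Mu13p
  proof (rule below_Wpar[where c = "Complex a 1" and k = 1 and y = ?y])
    show "bracket (Mu13p a) \<in> orb (br (Wpar (Complex a 1) 1))"
      by (simp add: bracket_br Xpar_orb)
    show "br (Wpar (Complex a 1) 0) \<in> orb (bracket ?y)"
      by (auto intro!: Wpar_0_Mu6 Wpar_0_Mu7 simp: complex_eq_iff)
    show "arrow (Mu13p a) ?y"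
      using arrow.intros(14)[of "1 / (2 * a)"] arrow.intros(15)[of "- 1 / (2 * a)"] arrow.intros(1)
      by (cases "a > 0"; cases "a = 0") (auto simp: divide_simps)
    show "arrow ?y Mu1" by (auto intro: arrow.intros)
  qed (use \<nu> Mu13p in \<open>auto simp: complex_eq_iff\<close>)
next
  case (Mu13m a)
  let ?y = "if a = 0 then Mu7 0 else Mu6 (1/2) (- 1 / (2 * a))"
  show ?thesis
    unfolding Mu13m
  proof (rule below_Wpar[where c = "Complex a (- 1)" and k = 1 and y = ?y])
    show "bracket (Mu13m a) \<in> orb (br (Wpar (Complex a (- 1)) 1))"
      by (simp add: bracket_br Xpar_orb)
    show "br (Wpar (Complex a (- 1)) 0) \<in> orb (bracket ?y)"
      by (auto intro!: Wpar_0_Mu6 Wpar_0_Mu7 simp: complex_eq_iff)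
    show "arrow (Mu13m a) ?y"
      using arrow.intros(16)[of "1 / (2 * a)"] arrow.intros(13)[of "- 1 / (2 * a)"] arrow.intros(2)
      by (cases "a > 0"; cases "a = 0") (auto simp: divide_simps)
    show "arrow ?y Mu1" by (auto intro: arrow.intros)
  qed (use \<nu> Mu13m in \<open>auto simp: complex_eq_iff\<close>)
next
  case Mu14
  have "\<nu> \<in> orb (bracket Mu14) \<or> \<nu> \<in> orb (bracket (Mu10 2)) \<or> \<nu> \<in> orb (bracket Mu1) \<or> \<nu> = 0"
    using closure_Vpar[of 1 "- \<i> / 2" \<nu>] \<nu> Mu14_Vpar Mu10_2_Vpar by (simp add: Mu14)
  then show ?thesis
    unfolding Mu14 by (rule below_arrow[OF _ arrow.intros(20,27)])
qed

section \<open>Degenerations along the arrows\<close>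

definition hseq :: "nat \<Rightarrow> complex" where "hseq n = of_real (inverse (real (Suc n)))"

lemma hseq: "hseq n \<noteq> 0" "cnj (hseq n) = hseq n" "hseq \<longlonglongrightarrow> 0"
proof -
  show "hseq \<longlonglongrightarrow> 0"
    unfolding hseq_def using tendsto_of_real[OF LIMSEQ_inverse_real_of_nat, where 'a = complex] by simp
qed (simp_all add: hseq_def del: of_nat_Suc)

lemma closure_orb_seqI:
  assumes "\<And>n. br (f n) \<in> orb \<mu>" "f \<longlonglongrightarrow> x"
  shows "br x \<in> closure (orb \<mu>)"
proof -
  have "(\<lambda>n. br (f n)) \<longlonglongrightarrow> br x"
    using continuous_on_tendsto_compose[OF continuous_on_br[of UNIV] assms(2)] by simp
  then show ?thesis
    unfolding closure_sequential using assms(1) by (intro exI[of _ "\<lambda>n. br (f n)"]) simp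
qed

lemma closure_orb_orb:
  assumes "\<nu> \<in> closure (orb \<mu>)" "\<mu> \<in> orb \<mu>'" "\<nu>' \<in> orb \<nu>"
  shows "\<nu>' \<in> closure (orb \<mu>')"
proof -
  have "\<nu>' \<in> closure (orb \<nu>)"
    using assms(3) closure_subset by blast
  then have "\<nu>' \<in> closure (orb \<mu>)"
    by (rule closure_orb_trans[OF assms(1)])
  then show ?thesis using orb_eq[OF assms(2)] by simp
qed

lemma degen_Ipar_0: "br (Ipar 0 0 0 0 0) \<in> closure (orb (br (Ipar A B R P p)))"
proof (rule closure_orb_seqI)
  show "br (Ipar (hseq n * A) (hseq n * B) (hseq n * R) (hseq n * P) (hseq n * hseq n * p)) \<in> orb (br (Ipar A B R P p))" for n
    by (rule orb_Ipar[of "hseq n" 1 _ _ _ _ _ _ _ _ _ _ 0]) (simp_all add: hseq)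
  have "(\<lambda>n. Ipar (hseq n * A) (hseq n * B) (hseq n * R) (hseq n * P) (hseq n * hseq n * p))
    \<longlonglongrightarrow> Ipar (0 * A) (0 * B) (0 * R) (0 * P) (0 * 0 * p)"
    unfolding Ipar_def by (intro tendsto_intros hseq)
  then show "(\<lambda>n. Ipar (hseq n * A) (hseq n * B) (hseq n * R) (hseq n * P) (hseq n * hseq n * p))
    \<longlonglongrightarrow> Ipar 0 0 0 0 0" by simp
qed

text \<open>Weights \<open>h\<close> and \<open>h * h\<close> on the two basis vectors shrink
  \<open>A\<close>, \<open>B\<close>, \<open>R\<close>, \<open>P\<close> by \<open>h\<close> but
  preserve \<open>p\<close>. The number required to be nonzero is \<open>p\<close> after the shear
  by \<open>\<beta>\<close>; a suitable \<open>\<beta>\<close> exists unless \<open>p = 0\<close>,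
  \<open>B = P\<close> and \<open>R = 0\<close>.\<close>

lemma degen_Ipar_Mu1:
  assumes k: "p + \<beta> * (B - P) + cnj \<beta> * R \<noteq> 0" (is "?k \<noteq> 0")
  shows "bracket Mu1 \<in> closure (orb (br (Ipar A B R P p)))"
proof -
  have "br (Ipar 0 0 0 0 ?k) \<in> closure (orb (br (Ipar A B R P p)))"
  proof (rule closure_orb_seqI)
    show "br (Ipar (hseq n * A) (hseq n * B) (hseq n * R) (hseq n * P) ?k) \<in> orb (br (Ipar A B R P p))" for n
      by (rule orb_Ipar[of "hseq n" "hseq n * hseq n" _ _ _ _ _ _ _ _ _ _ "hseq n * \<beta>"]) (simp_all add: hseq algebra_simps)
    have "(\<lambda>n. Ipar (hseq n * A) (hseq n * B) (hseq n * R) (hseq n * P) ?k)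
      \<longlonglongrightarrow> Ipar (0 * A) (0 * B) (0 * R) (0 * P) ?k"
      unfolding Ipar_def by (intro tendsto_intros hseq)
    then show "(\<lambda>n. Ipar (hseq n * A) (hseq n * B) (hseq n * R) (hseq n * P) ?k)
      \<longlonglongrightarrow> Ipar 0 0 0 0 ?k" by simp
  qed
  moreover have "bracket Mu1 \<in> orb (br (Ipar 0 0 0 0 ?k))"
  proof -
    have "br (Ipar 0 0 0 0 ?k) \<noteq> 0"
      using k unfolding br_0[symmetric] br_inject by (simp add: Ipar_def)
    then show ?thesis using Ipar_0_cases orb_sym by blast
  qed
  ultimately show ?thesis using closure_orb_orb orb_refl by blast
qed

lemma degen_Ipar_shear: "br (Ipar A B R P 0) \<in> closure (orb (br (Ipar A B R P p)))"
proof (rule closure_orb_seqI)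
  show "br (Ipar A B R P (hseq n * p)) \<in> orb (br (Ipar A B R P p))" for n
    by (rule orb_Ipar[of 1 "1 / hseq n" _ _ _ _ _ _ _ _ _ _ 0]) (simp_all add: hseq)
  have "(\<lambda>n. Ipar A B R P (hseq n * p)) \<longlonglongrightarrow> Ipar A B R P (0 * p)"
    unfolding Ipar_def by (intro tendsto_intros hseq)
  then show "(\<lambda>n. Ipar A B R P (hseq n * p)) \<longlonglongrightarrow> Ipar A B R P 0" by simp
qed

lemma degen_Wpar_0: "br (Wpar c 0) \<in> closure (orb (br (Wpar c k)))"
proof (rule closure_orb_seqI)
  show "br (Wpar c (hseq n * hseq n * k)) \<in> orb (br (Wpar c k))" for n
    by (rule orb_brI[of "hseq n" 1 0 0]) (simp_all add: Wpar_def hseq)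
  have "(\<lambda>n. Wpar c (hseq n * hseq n * k)) \<longlonglongrightarrow> Wpar c (0 * 0 * k)"
    unfolding Wpar_def by (intro tendsto_intros hseq) simp
  then show "(\<lambda>n. Wpar c (hseq n * hseq n * k)) \<longlonglongrightarrow> Wpar c 0" by simp
qed

lemma degen_Wpar_Vpar:
  assumes r: "r < 0" "k = of_real r * cnj c"
  shows "br (Vpar c 0) \<in> closure (orb (br (Wpar c k)))"
proof (rule closure_orb_seqI)
  let ?f = "\<lambda>n. (- hseq n * c / 2, c / 2, c / 2, 0, 0, complex_of_real (Re c), hseq n * c / 2, cnj c / 2, 0, hseq n * of_real (Re c))"
  \<comment> \<open>Chosen so that \<open>a * a * k = - cnj c\<close>: with shear 1 the numerator of
    the critical entry vanishes, and the second diagonal entry can tend to 0.\<close>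
  define a where "a = complex_of_real (sqrt (- 1 / r))"
  have "a * a = of_real (- 1 / r)" using r(1) by (simp add: a_def divide_simps flip: of_real_mult)
  then have a: "a * (a * k) = - cnj c" using r by (simp flip: mult.assoc)
  have "a \<noteq> 0" "cnj a = a" using r(1) by (simp_all add: a_def)
  moreover have re: "complex_of_real (Re c) = (c + cnj c) / 2" by (simp add: complex_eq_iff)
  ultimately show "br (?f n) \<in> orb (br (Wpar c k))" for n
    by (intro orb_brI[of a "hseq n" 0 1]) (simp_all add: Wpar_def hseq re a field_simps)
  have "?f \<longlonglongrightarrow> (- 0 * c / 2, c / 2, c / 2, 0, 0, complex_of_real (Re c), 0 * c / 2, cnj c / 2, 0, 0 * of_real (Re c))"
    by (intro tendsto_intros hseq) simp_all
  then show "?f \<longlonglongrightarrow> Vpar c 0" by (simp add: Vpar_def Ipar_def)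
qed

lemma degen_Mu2: "bracket (Mu10 1) \<in> closure (orb (bracket Mu2))" (is ?A)
  "bracket (Mu6 0 0) \<in> closure (orb (bracket Mu2))" (is ?B)
proof -
  \<comment> \<open>With first diagonal entry 1 and shear \<open>b\<close>, the critical numerator
    is \<open>b * (b - 1)\<close>, zero for both values of \<open>b\<close>.\<close>
  let ?f = "\<lambda>b n. (0, 0, 1 / 2, 0, 0, b / 2, 0, b / 2, 0, hseq n / 2) :: par"
  have "br (?f b n) \<in> orb (br (prm Mu2))" if "b = 0 \<or> b = 1" for b n
    using that by (intro orb_brI[of 1 "hseq n" 0 b]) (auto simp: hseq)
  moreover have "?f b \<longlonglongrightarrow> (0, 0, 1 / 2, 0, 0, b / 2, 0, b / 2, 0, 0 / 2)" for b
    by (intro tendsto_intros hseq) simp_all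
  ultimately have "br (0, 0, 1 / 2, 0, 0, b / 2, 0, b / 2, 0, 0 / 2) \<in> closure (orb (br (prm Mu2)))"
    if "b = 0 \<or> b = 1" for b
    using that closure_orb_seqI[of "?f b"] by blast
  from this[of 1] this[of 0] show ?A ?B
    by (simp_all add: bracket_br Ipar_def Complex_eq)
qed

lemma degen_Mu4: "bracket (Mu10 1) \<in> closure (orb (bracket Mu4))" (is ?A)
  "bracket (Mu3 0 1) \<in> closure (orb (bracket Mu4))" (is ?B)
proof -
  \<comment> \<open>The shear equals the first diagonal entry, so the critical numerator vanishes;
    the factor \<open>\<i>\<close> in the second entry turns the sign of \<open>R\<close>.\<close>
  let ?f = "\<lambda>n. (0, 0, 1 / 2, 0, 0, 1 / 2, - \<i> * hseq n / 2, 1 / 2, 0, 0) :: par"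
  have "br (?f n) \<in> orb (br Dpar)" for n
    by (intro orb_brI[of 1 "\<i> * hseq n" 0 1]) (simp_all add: hseq Dpar_def)
  moreover have "?f \<longlonglongrightarrow> (0, 0, 1 / 2, 0, 0, 1 / 2, - \<i> * 0 / 2, 1 / 2, 0, 0)"
    by (intro tendsto_intros hseq) simp_all
  ultimately have "br (0, 0, 1 / 2, 0, 0, 1 / 2, - \<i> * 0 / 2, 1 / 2, 0, 0) \<in> closure (orb (br Dpar))"
    by (rule closure_orb_seqI)
  then show ?A
    using orb_eq[OF Mu4_orb] by (simp add: bracket_br[of "Mu10 1"] Ipar_def)
  let ?g = "\<lambda>n. (0, 0, 0, 0, 0, 1, hseq n / 2, 0, 0, 0) :: par"
  have "br (?g n) \<in> orb (br Dpar)" for n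
    by (intro orb_brI[of 2 "hseq n" 0 0]) (simp_all add: hseq Dpar_def)
  moreover have "?g \<longlonglongrightarrow> (0, 0, 0, 0, 0, 1, 0 / 2, 0, 0, 0)"
    by (intro tendsto_intros hseq) simp_all
  ultimately have "br (0, 0, 0, 0, 0, 1, 0 / 2, 0, 0, 0) \<in> closure (orb (br Dpar))"
    by (rule closure_orb_seqI)
  then show ?B
    using orb_eq[OF Mu4_orb] by (simp add: bracket_br[of "Mu3 0 1"] Ipar_def Complex_eq)
qed

lemma degen_Wpar:
  assumes "prm x = Wpar c k \<or> k = 1 \<and> prm x = Xpar c" "br (Wpar c 0) \<in> orb (bracket y)"
  shows "bracket y \<in> closure (orb (bracket x))"
proof (rule closure_orb_orb[OF degen_Wpar_0[of c k]])
  show "br (Wpar c k) \<in> orb (bracket x)"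
    using assms(1) orb_refl orb_sym[OF Xpar_orb] unfolding bracket_br by metis
  show "bracket y \<in> orb (br (Wpar c 0))"
    using assms(2) by (rule orb_sym)
qed

lemma arrow_closure: "arrow x y \<Longrightarrow> bracket y \<in> closure (orb (bracket x))"
proof (induction rule: arrow.induct)
  case 1
  show ?case by (rule degen_Wpar[where c = "Complex 0 1" and k = 1]) (auto intro: Wpar_0_Mu7 simp: Complex_eq)
next
  case 2
  show ?case by (rule degen_Wpar[where c = "Complex 0 (- 1)" and k = 1]) (auto intro: Wpar_0_Mu7 simp: Complex_eq)
next
  case (3 t)
  show ?case by (rule degen_Wpar[where c = "- \<i>" and k = "Complex t 1"]) (auto intro: Wpar_0_Mu7)
next
  case (4 t)
  show ?case by (rule degen_Wpar[where c = "- \<i>" and k = "Complex t (- 1)"]) (auto intro: Wpar_0_Mu7)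
next
  case 5
  have "br (Vpar (- \<i>) 0) \<in> closure (orb (br (prm (Mu8m 0))))"
    unfolding prm.simps by (rule degen_Wpar_Vpar[of "- 1"]) (simp_all add: Complex_eq)
  then show ?case
    using closure_orb_orb orb_refl orb_sym[OF Vpar_Mu10_0] bracket_br by metis
next
  case 6
  have "br (Vpar (- \<i>) 0) \<in> closure (orb (br (Vpar (- \<i>) (1 / 2))))"
    unfolding Vpar_def by (rule degen_Ipar_shear)
  then show ?case
    using closure_orb_orb orb_sym[OF Mu12_orb] orb_sym[OF Vpar_Mu10_0] by metis
next
  case 11
  show ?case
    using degen_Ipar_shear[of 1 0 0 0 "1/2"] by (simp add: bracket_br[of Mu5] bracket_br[of "Mu3 0 (-1)"] Complex_eq)
next
  case 12
  show ?case
    unfolding bracket_br[of Mu5] prm.simps by (rule degen_Ipar_Mu1[where \<beta> = 0]) simp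
next
  case (13 \<delta>)
  then show ?case
    by (intro degen_Wpar[where c = "Complex (- 1 / (2 * \<delta>)) (- 1)" and k = 1])
      (auto intro!: Wpar_0_Mu6)
next
  case (14 \<delta>)
  then show ?case
    by (intro degen_Wpar[where c = "Complex (1 / (2 * \<delta>)) 1" and k = 1])
      (auto intro!: Wpar_0_Mu6)
next
  case (15 \<delta>)
  then show ?case
    by (intro degen_Wpar[where c = "Complex (- 1 / (2 * \<delta>)) 1" and k = 1])
      (auto intro!: Wpar_0_Mu6)
next
  case (16 \<delta>)
  then show ?case
    by (intro degen_Wpar[where c = "Complex (1 / (2 * \<delta>)) (- 1)" and k = 1])
      (auto intro!: Wpar_0_Mu6)
next
  case 17
  show ?case by (rule degen_Wpar[where c = "1 / 2" and k = 1]) (auto intro: Wpar_0_Mu6)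
next
  case 18
  show ?case by (rule degen_Wpar[where c = "- 1 / 2" and k = 1]) (auto intro: Wpar_0_Mu6)
next
  case 19
  have "br (Vpar (- 1 / 2) 0) \<in> closure (orb (br (Wpar (- 1 / 2) 1)))"
    by (rule degen_Wpar_Vpar[of "- 2"]) simp_all
  moreover have "br (Wpar (- 1 / 2) 1) \<in> orb (bracket Mu11m)"
    unfolding bracket_br prm.simps using orb_sym[OF Xpar_orb] .
  ultimately show ?case
    using closure_orb_orb orb_sym[OF Vpar_Mu10_2] by metis
next
  case 20
  show ?case unfolding Mu14_Vpar Mu10_2_Vpar Vpar_def by (rule degen_Ipar_shear)
next
  case 21
  show ?case
    using degen_Ipar_shear[of "1/2" "1/2" 0 "1/2" "1/2"]
    by (simp add: bracket_br[of Mu9] bracket_br[of "Mu6 1 0"] Complex_eq)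
next
  case 22
  show ?case
    unfolding bracket_br[of Mu9] prm.simps by (rule degen_Ipar_Mu1[where \<beta> = 0]) simp
next
  case (23 b a)
  then show ?case
    unfolding bracket_br[of "Mu3 a b"] prm.simps
    by (intro degen_Ipar_Mu1[where \<beta> = 1]) (auto simp: complex_eq_iff)
next
  case 24
  show ?case
    unfolding bracket_br[of "Mu3 0 0"] prm.simps
    by (rule degen_Ipar_Mu1[where \<beta> = 1]) (simp add: complex_eq_iff)
next
  case (25 a b)
  then show ?case
    unfolding bracket_br[of "Mu6 a b"] prm.simps
    by (intro degen_Ipar_Mu1[where \<beta> = 1]) (auto simp: complex_eq_iff)
next
  case (26 a)
  show ?case
    unfolding bracket_br[of "Mu7 a"] prm.simps
    by (rule degen_Ipar_Mu1[where \<beta> = 1]) (simp add: complex_eq_iff)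
next
  case (27 a)
  show ?case
    unfolding bracket_br[of "Mu10 a"] prm.simps
    \<comment> \<open>The shear 1 contributes a/2, which is useless at \<open>a = 0\<close>; there
      \<open>\<i>\<close> contributes \<open>- \<i>\<close>.\<close>
    by (rule degen_Ipar_Mu1[where \<beta> = "if a = 0 then \<i> else 1"]) (simp add: complex_eq_iff)
next
  case 28
  show ?case
    using degen_Ipar_0 unfolding bracket_br prm.simps .
next
  case 29
  show ?case
    using degen_Ipar_0 unfolding bracket_br prm.simps .
next
  case 30
  show ?case
    using degen_Ipar_0 unfolding bracket_br prm.simps .
qed (fact degen_Mu2 degen_Mu4)+

section \<open>The Hasse diagram\<close>

text \<open>Having a complex line as abelian ideal is invariant under \<open>GLJ\<close>. Comparing
  constants shows that \<open>Mu2\<close>, \<open>Mu4\<close> and the families \<mu>_8, \<mu>_11,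
  \<mu>_13 have none.\<close>

lemma orb_Ipar_form:
  assumes y: "bracket y \<in> orb (br (Ipar A B R P p))"
  obtains A' B' R' P' p' where "prm y = Ipar A' B' R' P' p'"
proof -
  from y obtain \<alpha> \<beta> \<delta> \<gamma> where D: "\<alpha> * \<gamma> - \<delta> * \<beta> \<noteq> 0"
    and eq: "gmL \<alpha> \<beta> \<delta> \<gamma> (prm y) = gmR \<alpha> \<beta> \<delta> \<gamma> (Ipar A B R P p)"
    unfolding bracket_br orb_br_iff by blast
  have nW: "prm y \<noteq> Wpar c k" if "c \<noteq> 0" "k \<noteq> 0" for c k
  proof
    assume "prm y = Wpar c k"
    with eq that D show False by (auto simp: Wpar_def Ipar_def)
  qed
  have nX: "prm y \<noteq> Xpar c" if "c \<noteq> 0" for c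
  proof
    assume "prm y = Xpar c"
    with eq that D show False by (auto simp: Xpar_def Ipar_def)
  qed
  have n2: "y \<noteq> Mu2"
  proof
    assume "y = Mu2"
    with eq D show False by (auto simp: Ipar_def)
  qed
  have n4: "y \<noteq> Mu4"
  proof
    assume y: "y = Mu4"
    have "cnj \<alpha> * \<alpha> * P = \<alpha> / 2" "cnj \<delta> * \<delta> * P = - \<alpha> / 2" "P \<noteq> 0"
      using eq D unfolding y by (auto simp: Ipar_def)
    then have "(cnj \<alpha> * \<alpha> + cnj \<delta> * \<delta>) * P = 0" by (simp add: distrib_right)
    then have "cnj \<alpha> * \<alpha> + cnj \<delta> * \<delta> = 0" using \<open>P \<noteq> 0\<close> by simp
    then have "complex_of_real ((norm \<alpha>)\<^sup>2 + (norm \<delta>)\<^sup>2) = 0"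
      unfolding of_real_add complex_norm_square by (simp add: mult.commute)
    then have "\<alpha> = 0" "\<delta> = 0"
      by (auto simp only: of_real_eq_0_iff sum_power2_eq_zero_iff norm_eq_zero)
    then show False using D by simp
  qed
  show ?thesis
  proof (cases y)
    case (Mu8p a)
    with nW[of "- \<i>" "Complex a 1"] show ?thesis by (simp add: complex_eq_iff)
  next
    case (Mu8m a)
    with nW[of "- \<i>" "Complex a (- 1)"] show ?thesis by (simp add: complex_eq_iff)
  next
    case Mu11p
    with nX[of "1 / 2"] show ?thesis by simp
  next
    case Mu11m
    with nX[of "- 1 / 2"] show ?thesis by simp
  next
    case (Mu13p a)
    with nX[of "Complex a 1"] show ?thesis by (simp add: complex_eq_iff)
  next
    case (Mu13m a)
    with nX[of "Complex a (- 1)"] show ?thesis by (simp add: complex_eq_iff)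
  qed (use that n2 n4 in auto)
qed

text \<open>Under \<open>nz\<close> the change of basis must preserve the line through
  \<open>e 2\<close>, that is \<open>\<delta> = 0\<close>, and the triangular formulas
  apply.\<close>

lemma orb_Ipar_cases:
  assumes y: "bracket y \<in> orb (br (Ipar A B R P p))" and nz: "A \<noteq> 0 \<or> B + P \<noteq> 0"
  obtains \<alpha> \<beta> \<gamma> R' p' where "\<alpha> \<noteq> 0" "\<gamma> \<noteq> 0" "R' * \<gamma> = \<alpha> * R * cnj \<gamma>"
    "p' * \<gamma> = \<alpha> * cnj \<alpha> * p + cnj \<alpha> * \<beta> * (B - P) + \<alpha> * cnj \<beta> * R"
    "prm y = Ipar (\<alpha> * A) (cnj \<alpha> * B) R' (cnj \<alpha> * P) p'"
proof -
  from y obtain \<alpha> \<beta> \<delta> \<gamma> where D: "\<alpha> * \<gamma> - \<delta> * \<beta> \<noteq> 0"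
    and eq: "gmL \<alpha> \<beta> \<delta> \<gamma> (prm y) = gmR \<alpha> \<beta> \<delta> \<gamma> (Ipar A B R P p)"
    unfolding bracket_br orb_br_iff by blast
  obtain A' B' R' P' p' where x: "prm y = Ipar A' B' R' P' p'"
    using orb_Ipar_form[OF y] .
  have "\<delta> = 0"
  proof (cases "A = 0")
    case False
    then show ?thesis using eq D by (auto simp: x Ipar_def)
  next
    case A: True
    show ?thesis
    proof (rule ccontr)
      assume d: "\<delta> \<noteq> 0"
      then have P: "P = 0" using eq by (auto simp: x Ipar_def)
      then have "B' = 0" "R' = 0" using d eq by (auto simp: x Ipar_def)
      then have e: "cnj \<alpha> * \<delta> * p + cnj \<alpha> * \<gamma> * B + cnj \<beta> * \<delta> * R = 0"
        "cnj \<delta> * \<alpha> * p + cnj \<delta> * \<beta> * B + cnj \<gamma> * \<alpha> * R = 0"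
        "cnj \<delta> * \<delta> * p + cnj \<delta> * \<gamma> * B + cnj \<gamma> * \<delta> * R = 0"
        using eq by (auto simp: x Ipar_def P)
      \<comment> \<open>The combination of the last two equations that eliminates \<open>p\<close>
        and \<open>R\<close>.\<close>
      have "(\<alpha> * \<gamma> - \<delta> * \<beta>) * cnj \<delta> * B = \<alpha> * (cnj \<delta> * \<delta> * p + cnj \<delta> * \<gamma> * B + cnj \<gamma> * \<delta> * R)
        - \<delta> * (cnj \<delta> * \<alpha> * p + cnj \<delta> * \<beta> * B + cnj \<gamma> * \<alpha> * R)"
        by (simp add: algebra_simps)
      then have "B = 0" using D d unfolding e by simp
      then show False using nz A P by simp
    qed
  qed
  then show ?thesis
    using that[of \<alpha> \<gamma> R' p' \<beta>] D eq by (auto simp: x Ipar_def algebra_simps)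
qed

lemma orb_Mu0_unique: "bracket y \<in> orb (bracket Mu0) \<Longrightarrow> y = Mu0"
proof -
  assume "bracket y \<in> orb (bracket Mu0)"
  then have "prm y = prm Mu0"
    using bracket_br[of y] bracket_br[of Mu0] by (simp add: orb_0 flip: br_inject)
  then show ?thesis
    by (cases y) (auto simp: par_defs complex_eq_iff)
qed

text \<open>For \<open>Mu1\<close> itself \<open>nz\<close> fails, so \<open>orb_Ipar_cases\<close>
  is applied from \<open>y\<close> towards \<open>Mu1\<close>.\<close>

lemma orb_Mu1_unique:
  assumes "bracket y \<in> orb (bracket Mu1)"
  shows "y = Mu1"
proof -
  obtain A B R P p where y: "prm y = Ipar A B R P p"
    using assms orb_Ipar_form unfolding bracket_br[of Mu1] prm.simps by metis
  have "A = 0 \<and> B + P = 0"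
  proof (rule ccontr)
    assume nz: "\<not> (A = 0 \<and> B + P = 0)"
    have "bracket Mu1 \<in> orb (br (Ipar A B R P p))"
      using orb_sym[OF assms] unfolding bracket_br[of y] y .
    then obtain \<alpha> R' p' where "\<alpha> \<noteq> 0" "prm Mu1 = Ipar (\<alpha> * A) (cnj \<alpha> * B) R' (cnj \<alpha> * P) p'"
      using nz by (elim orb_Ipar_cases) auto
    then show False using nz by (simp add: Ipar_def)
  qed
  moreover have "y \<noteq> Mu0"
    using orb_sym[OF assms] orb_Mu0_unique[of Mu1] by auto
  ultimately show ?thesis
    using y by (cases y) (auto simp: par_defs complex_eq_iff)
qed

lemma orb_target_unique:
  assumes "arrow x z" and y: "bracket y \<in> orb (bracket z)"
  shows "y = z"
proof -
  have par: "\<exists>\<alpha> \<beta> \<gamma> R' p'. \<alpha> \<noteq> 0 \<and> \<gamma> \<noteq> 0 \<and> R' * \<gamma> = \<alpha> * R * cnj \<gamma> \<and>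
    p' * \<gamma> = \<alpha> * cnj \<alpha> * p + cnj \<alpha> * \<beta> * (B - P) + \<alpha> * cnj \<beta> * R \<and>
    prm y = Ipar (\<alpha> * A) (cnj \<alpha> * B) R' (cnj \<alpha> * P) p'"
    if "prm z = Ipar A B R P p" "A \<noteq> 0 \<or> B + P \<noteq> 0" for A B R P p
    using orb_Ipar_cases[of y A B R P p] y that unfolding bracket_br[of z] by metis
  consider "z = Mu0" | "z = Mu1" | "z = Mu3 0 1" | "z = Mu3 0 (- 1)" | a b where "z = Mu6 a b"
    | "z = Mu7 0" | a where "z = Mu10 a"
    using assms(1) by cases blast+
  then show ?thesis
  proof cases
    case 1
    then show ?thesis using y orb_Mu0_unique by simp
  next
    case 2
    then show ?thesis using y orb_Mu1_unique by simp
  next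
    case 3
    from par[of 0 1 0 0 0] show ?thesis
      unfolding 3 by (cases y) (auto simp: par_defs Complex_eq complex_eq_iff)
  next
    case 4
    from par[of 1 0 0 0 0] show ?thesis
      unfolding 4 by (cases y) (auto simp: par_defs Complex_eq complex_eq_iff)
  next
    case (5 a b)
    from par[OF 5[THEN arg_cong, of prm, unfolded prm.simps]] show ?thesis
      unfolding 5 by (cases y) (auto simp: par_defs Complex_eq complex_eq_iff)
  next
    case 6
    from par[OF 6[THEN arg_cong, of prm, unfolded prm.simps]]
    obtain \<alpha> R' p' where "\<alpha> \<noteq> 0" "prm y = Ipar (\<alpha> * \<i> / 2) (cnj \<alpha> * \<i> / 2) R' 0 p'"
      by (auto simp: Complex_eq)
    \<comment> \<open>Hiding \<open>\<alpha>\<close> keeps just the relation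
      \<open>A = - cnj B\<close>, which no \<open>Mu3 a b\<close> satisfies and \<open>Mu7 a\<close>
      satisfies only for \<open>a = 0\<close>.\<close>
    moreover define A B where "A = \<alpha> * \<i> / 2" and "B = cnj \<alpha> * \<i> / 2"
    ultimately have "A = - cnj B" "B \<noteq> 0" "prm y = Ipar A B R' 0 p'"
      unfolding A_def B_def by simp_all
    then show ?thesis
      unfolding 6 by (cases y) (auto simp: par_defs complex_eq_iff)
  next
    case (7 a)
    from par[OF 7[THEN arg_cong, of prm, unfolded prm.simps]]
    obtain \<alpha> \<beta> \<gamma> R' p' where nz: "\<alpha> \<noteq> 0" "\<gamma> \<noteq> 0" and R: "R' * \<gamma> = \<alpha> * (1 / 2) * cnj \<gamma>"
      and p: "p' * \<gamma> = cnj \<alpha> * \<beta> * (of_real a / 2 - 1 / 2) + \<alpha> * cnj \<beta> * (1 / 2)"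
      and eq: "prm y = Ipar (\<alpha> * (of_real (a - 1) / 2)) (cnj \<alpha> * (of_real a / 2)) R' (cnj \<alpha> * (1 / 2)) p'"
      by auto
    have "R' \<noteq> 0" using R nz by auto
    have one: "\<alpha> = 1" if "cnj \<alpha> * (1 / 2) = 1 / 2"
      using that by (simp add: complex_eq_iff)
    show ?thesis
    proof (cases y)
      case (Mu10 b)
      then show ?thesis
        using eq one 7 by (auto simp: Ipar_def)
    next
      case Mu12
      then have *: "\<alpha> = 1" "a = 0" "R' = 1 / 2" "p' = 1 / 2"
        using eq one by (auto simp: Ipar_def)
      \<comment> \<open>The equation for \<open>R\<close> makes \<open>\<gamma>\<close> real and the
        one for \<open>p\<close> makes it imaginary, contradicting
        \<open>\<gamma> \<noteq> 0\<close>.\<close>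
      have "cnj \<gamma> = \<gamma>" "Im \<gamma> = 0 \<Longrightarrow> Re \<gamma> = 0"
        using R p unfolding * by (simp_all add: complex_eq_iff)
      then show ?thesis
        using nz by (auto simp: complex_eq_iff)
    next
      case Mu14
      then have *: "\<alpha> = 1" "a = 2" "R' = 1 / 2" "p' = - \<i> / 2"
        using eq one by (auto simp: Ipar_def complex_eq_iff[of "of_real a"])
      have "cnj \<gamma> = \<gamma>" "Im \<gamma> = 0 \<Longrightarrow> Re \<gamma> = 0"
        using R p unfolding * by (simp_all add: complex_eq_iff)
      then show ?thesis
        using nz by (auto simp: complex_eq_iff)
    qed (use eq nz \<open>R' \<noteq> 0\<close> in \<open>simp_all add: par_defs\<close>)
  qed
qed

text \<open>For listed names this is the length of every chain of arrows down to
  \<open>Mu0\<close>.\<close>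

fun rank :: "mu_name \<Rightarrow> nat" where
  "rank Mu0 = 0" | "rank Mu1 = 1" | "rank Mu5 = 2" | "rank Mu9 = 2"
| "rank (Mu3 a b) = (if (a, b) = (0, - 1) then 1 else 2)"
| "rank (Mu6 a b) = (if (a, b) = (1, 0) then 1 else 2)"
| "rank (Mu7 a) = 2" | "rank (Mu10 a) = 2"
| "rank _ = 3"

lemma arrow_rank: "arrow x y \<Longrightarrow> rank x = Suc (rank y)"
  by (induction rule: arrow.induct) auto

lemma arrows_rank: "arrow\<^sup>+\<^sup>+ x y \<Longrightarrow> rank y < rank x"
  by (induction rule: tranclp_induct) (auto dest!: arrow_rank)

lemma arrow_listed: "arrow x y \<Longrightarrow> listed y"
  by (induction rule: arrow.induct) auto

lemma arrows_target: "arrow\<^sup>+\<^sup>+ x y \<Longrightarrow> \<exists>w. arrow w y"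
  by (metis tranclp.cases)

lemma arrows_unique:
  "arrow\<^sup>+\<^sup>+ x z \<Longrightarrow> bracket y \<in> orb (bracket z) \<Longrightarrow> y = z"
  using arrows_target orb_target_unique by blast

lemma arrows_listed: "arrow\<^sup>+\<^sup>+ x y \<Longrightarrow> listed y"
  using arrows_target arrow_listed by blast

lemma arrows_closure: "arrow\<^sup>+\<^sup>+ x y \<Longrightarrow> bracket y \<in> closure (orb (bracket x))"
  by (induction rule: tranclp_induct) (blast intro: arrow_closure closure_orb_trans)+

lemma arrows_not_orb:
  assumes "listed x" "arrow\<^sup>+\<^sup>+ x y"
  shows "bracket y \<notin> orb (bracket x)"
  using arrows_unique[OF assms(2)] orb_sym arrows_rank[OF assms(2)] by blast

lemma closure_arrows:
  assumes "listed x" "\<nu> \<in> closure (orb (bracket x))" "\<nu> \<notin> orb (bracket x)"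
  obtains z where "arrow\<^sup>+\<^sup>+ x z" "\<nu> \<in> orb (bracket z)"
  using below_closure[OF assms(1,2)] assms(3) unfolding below_def by (metis rtranclpD)

lemma properly_degenerates_iff:
  assumes "listed x" "listed y"
  shows "properly_degenerates (bracket x) (bracket y) \<longleftrightarrow> arrow\<^sup>+\<^sup>+ x y"
proof
  assume "properly_degenerates (bracket x) (bracket y)"
  then show "arrow\<^sup>+\<^sup>+ x y"
    using closure_arrows[OF assms(1)] arrows_unique
    unfolding properly_degenerates_def degenerates_def by metis
qed (use assms arrows_closure arrows_not_orb bracket_LJ in
    \<open>simp add: properly_degenerates_def degenerates_def\<close>)

lemma orbit_gt_arrows:
  assumes "listed x" "arrow\<^sup>+\<^sup>+ x y"
  shows "orbit_gt (orb (bracket x)) (orb (bracket y))"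
  using arrows_closure[OF assms(2)] arrows_not_orb[OF assms] bracket_LJ orb_refl
  unfolding orbit_gt_def orbit_ge_def degenerates_def by blast

text \<open>The orbit \<open>C\<close> is arbitrary, yet any of its points in the closure already
  lies in the orbit of a name reached by arrows.\<close>

lemma orbit_gt_cases:
  assumes "listed x" "orbit_gt (orb (bracket x)) C"
  obtains z where "arrow\<^sup>+\<^sup>+ x z" "C = orb (bracket z)"
proof -
  obtain \<mu> \<nu> where "orb (bracket x) = orb \<mu>" "C = orb \<nu>" "\<nu> \<in> closure (orb \<mu>)" "C \<noteq> orb (bracket x)"
    using assms(2) unfolding orbit_gt_def orbit_ge_def degenerates_def by blast
  then show ?thesis
    using closure_arrows[OF assms(1), of \<nu>] that orb_eq by metis
qed

lemma covers_iff:
  assumes "listed x" "listed y"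
  shows "covers (orb (bracket x)) (orb (bracket y)) \<longleftrightarrow> arrow x y"
proof
  assume c: "covers (orb (bracket x)) (orb (bracket y))"
  then obtain z where z: "arrow\<^sup>+\<^sup>+ x z" "orb (bracket y) = orb (bracket z)"
    using orbit_gt_cases[OF assms(1)] unfolding covers_def by metis
  then have "arrow\<^sup>+\<^sup>+ x y"
    using arrows_unique[OF z(1)] orb_refl by metis
  \<comment> \<open>If the first arrow of the chain does not end at \<open>y\<close>, the orbit of
    its target lies strictly between, against the covering property.\<close>
  then obtain w where w: "arrow x w" "arrow\<^sup>*\<^sup>* w y" by (metis tranclpD)
  show "arrow x y"
  proof (cases "w = y")
    case False
    then have "arrow\<^sup>+\<^sup>+ w y" using w(2) by (metis rtranclpD)
    then have "orbit_gt (orb (bracket w)) (orb (bracket y))"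
      by (rule orbit_gt_arrows[OF arrow_listed[OF w(1)]])
    moreover have "orbit_gt (orb (bracket x)) (orb (bracket w))"
      using assms(1) w(1) by (blast intro: orbit_gt_arrows)
    ultimately show ?thesis
      using c bracket_LJ unfolding covers_def orbits_def by blast
  qed (use w in simp)
next
  assume a: "arrow x y"
  have "False" if C: "orbit_gt (orb (bracket x)) C" "orbit_gt C (orb (bracket y))" for C
  proof -
    obtain z where z: "arrow\<^sup>+\<^sup>+ x z" "C = orb (bracket z)"
      using orbit_gt_cases[OF assms(1) C(1)] .
    obtain w where w: "arrow\<^sup>+\<^sup>+ z w" "orb (bracket y) = orb (bracket w)"
      using orbit_gt_cases[OF arrows_listed[OF z(1)] C(2)[unfolded z(2)]] .
    have "y = w"
      using arrows_unique[OF w(1)] w(2) orb_refl by metis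
    then show False
      using arrows_rank[OF z(1)] arrows_rank[OF w(1)] arrow_rank[OF a] by simp
  qed
  then show "covers (orb (bracket x)) (orb (bracket y))"
    using orbit_gt_arrows[OF assms(1)] a bracket_LJ unfolding covers_def orbits_def by blast
qed

theorem theorem3p4:
  shows "\<forall>x y. listed x \<and> listed y \<longrightarrow>
           (covers (orb (bracket x)) (orb (bracket y)) \<longleftrightarrow> arrow x y) \<and>
           (properly_degenerates (bracket x) (bracket y) \<longleftrightarrow> arrow\<^sup>+\<^sup>+ x y)"
  using covers_iff properly_degenerates_iff by blast

end
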